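(* Let $(M,L_M)$ and $(N,L_N)$ be Lip-von Neumann algebras with $\mathrm{dist}_{qGH^*}(M,N)=0$. Then $(M,L_M)$ and $(N,L_N)$ are isomorphic as Lip-von Neumann algebras, i.e. there is a ${}^*$-isomorphism $\phi:M\to N$ with $L_N(\phi(x))=L_M(x)$ for all $x\in M$.
   Context: A Lip-von Neumann algebra (LvNA) is a pair $(M,L_M)$ where $M$ is a von Neumann algebra and $L_M$ is a norm on $M$ (everywhere finite) inducing the $w^*$-topology on bounded subsets of $M$ (equivalently, the closed unit ball $M_1=\{x\in M:\|x\|\le 1\}$ is compact in the $L_M$-topology). $L_M$ is extended to $\mathcal M_2(M)$ ($2\times2$ matrices over $M$) by $L_M((a_{ij}))=\max_{i,j}L_M(a_{ij})$. For LvNAs $(M,L_M)$, $(N,L_N)$, $\mathcal L(M,N)$ is the set of seminorms $L$ on $M\oplus N$ with $L(x,0)=L_M(x)$ and $L(0,y)=L_N(y)$ for all $x\in M,y\in N$; each such $L$ is extended to $\mathcal M_2(M)\oplus\mathcal M_2(N)\cong\mathcal M_2(M\oplus N)$ by entrywise maximum. $X_M=\{x\in\mathcal M_2(M): x\ge 0,\ \|x\|\le 1\}$, and similarly $X_N$. For $L\in\mathcal L(M,N)$, $\mathrm{dist}^L_H(X_M,X_N)=\max\big(\sup_{x\in X_M}\inf_{y\in X_N}L(x,-y),\ \sup_{y\in X_N}\inf_{x\in X_M}L(x,-y)\big)$, and the dual quantum Gromov–Hausdorff distance is $\mathrm{dist}_{qGH^*}(M,N)=\inf_{L\in\mathcal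 L(M,N)}\mathrm{dist}^L_H(X_M,X_N)$. *)

theory Defs
  imports "HOL-Analysis.Analysis"
begin

text \<open>Concrete Hilbert spaces: every complex Hilbert space is unitarily isomorphic to
  some l2(I); we model H = l2('i) for an arbitrary index type 'i.  Operators are maps
  on 'i vec that are bounded linear on l2 and vanish (by convention) off l2.\<close>

type_synonym 'i vec = "'i \<Rightarrow> complex"
type_synonym 'i op = "'i vec \<Rightarrow> 'i vec"

definition l2 :: "'i vec set" where
  "l2 = {f. (\<lambda>i. (cmod (f i))\<^sup>2) summable_on UNIV}"

definition inner_l2 :: "'i vec \<Rightarrow> 'i vec \<Rightarrow> complex" where
  "inner_l2 f g = infsum (\<lambda>i. cnj (f i) * g i) UNIV"

definition norm_l2 :: "'i vec \<Rightarrow> real" where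
  "norm_l2 f = sqrt (infsum (\<lambda>i. (cmod (f i))\<^sup>2) UNIV)"

definition bop :: "'i op set" where
  "bop = {T. (\<forall>v\<in>l2. T v \<in> l2)
          \<and> (\<forall>u\<in>l2. \<forall>v\<in>l2. \<forall>a b::complex.
               T (\<lambda>i. a * u i + b * v i) = (\<lambda>i. a * T u i + b * T v i))
          \<and> (\<exists>C. \<forall>v\<in>l2. norm_l2 (T v) \<le> C * norm_l2 v)
          \<and> (\<forall>v. v \<notin> l2 \<longrightarrow> T v = (\<lambda>_. 0))}"

definition op_zero :: "'i op" where "op_zero = (\<lambda>v i. 0)"
definition op_id :: "'i op" where "op_id = (\<lambda>v. if v \<in> l2 then v else (\<lambda>_. 0))"
definition op_add :: "'i op \<Rightarrow> 'i op \<Rightarrow> 'i op" where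
  "op_add S T = (\<lambda>v i. S v i + T v i)"
definition op_scale :: "complex \<Rightarrow> 'i op \<Rightarrow> 'i op" where
  "op_scale a T = (\<lambda>v i. a * T v i)"
definition op_comp :: "'i op \<Rightarrow> 'i op \<Rightarrow> 'i op" where
  "op_comp S T = S \<circ> T"

definition adjoint :: "'i op \<Rightarrow> 'i op" where
  "adjoint T = (THE S. S \<in> bop \<and> (\<forall>u\<in>l2. \<forall>v\<in>l2. inner_l2 (T u) v = inner_l2 u (S v)))"

definition op_norm :: "'i op \<Rightarrow> real" where
  "op_norm T = Sup {norm_l2 (T v) | v. v \<in> l2 \<and> norm_l2 v \<le> 1}"

definition commutant :: "'i op set \<Rightarrow> 'i op set" where
  "commutant A = {S \<in> bop. \<forall>T\<in>A. op_comp S T = op_comp T S}"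

definition von_neumann_algebra :: "'i op set \<Rightarrow> bool" where
  "von_neumann_algebra M \<longleftrightarrow> M \<subseteq> bop \<and> op_id \<in> M
     \<and> (\<forall>x\<in>M. \<forall>y\<in>M. op_add x y \<in> M \<and> op_comp x y \<in> M)
     \<and> (\<forall>a. \<forall>x\<in>M. op_scale a x \<in> M)
     \<and> (\<forall>x\<in>M. adjoint x \<in> M)
     \<and> commutant (commutant M) = M"

definition norm_on :: "'i op set \<Rightarrow> ('i op \<Rightarrow> real) \<Rightarrow> bool" where
  "norm_on M L \<longleftrightarrow> (\<forall>x\<in>M. 0 \<le> L x \<and> (L x = 0 \<longleftrightarrow> x = op_zero))
     \<and> (\<forall>a. \<forall>x\<in>M. L (op_scale a x) = cmod a * L x)
     \<and> (\<forall>x\<in>M. \<forall>y\<in>M. L (op_add x y) \<le> L x + L y)"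

text \<open>Relative openness in a subset B for the weak operator topology
  (which agrees with the w*- (sigma-weak) topology on bounded subsets).\<close>
definition wot_open_in :: "'i op set \<Rightarrow> 'i op set \<Rightarrow> bool" where
  "wot_open_in B U \<longleftrightarrow> U \<subseteq> B \<and> (\<forall>x\<in>U. \<exists>F \<epsilon>. finite F \<and> F \<subseteq> l2 \<times> l2 \<and> \<epsilon> > 0 \<and>
      (\<forall>y\<in>B. (\<forall>(u,v)\<in>F. cmod (inner_l2 u (y v) - inner_l2 u (x v)) < \<epsilon>) \<longrightarrow> y \<in> U))"

definition L_open_in :: "('i op \<Rightarrow> real) \<Rightarrow> 'i op set \<Rightarrow> 'i op set \<Rightarrow> bool" where
  "L_open_in L B U \<longleftrightarrow> U \<subseteq> B \<and> (\<forall>x\<in>U. \<exists>\<epsilon>>0.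
      \<forall>y\<in>B. L (op_add y (op_scale (-1) x)) < \<epsilon> \<longrightarrow> y \<in> U)"

definition LvNA :: "'i op set \<Rightarrow> ('i op \<Rightarrow> real) \<Rightarrow> bool" where
  "LvNA M L \<longleftrightarrow> von_neumann_algebra M \<and> norm_on M L
     \<and> (\<forall>r. \<forall>U. wot_open_in {x\<in>M. op_norm x \<le> r} U
                 \<longleftrightarrow> L_open_in L {x\<in>M. op_norm x \<le> r} U)"

type_synonym 'i mat2 = "bool \<Rightarrow> bool \<Rightarrow> 'i op"

definition mat_apply :: "'i mat2 \<Rightarrow> (bool \<Rightarrow> 'i vec) \<Rightarrow> (bool \<Rightarrow> 'i vec)" where
  "mat_apply a \<xi> = (\<lambda>i k. a i False (\<xi> False) k + a i True (\<xi> True) k)"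

definition X_set :: "'i op set \<Rightarrow> 'i mat2 set" where
  "X_set M = {a. (\<forall>i j. a i j \<in> M)
     \<and> (\<forall>\<xi>. (\<forall>i. \<xi> i \<in> l2) \<longrightarrow>
          (let z = inner_l2 (\<xi> False) (mat_apply a \<xi> False) + inner_l2 (\<xi> True) (mat_apply a \<xi> True)
           in 0 \<le> Re z \<and> Im z = 0))
     \<and> (\<forall>\<xi>. (\<forall>i. \<xi> i \<in> l2) \<longrightarrow>
          (norm_l2 (mat_apply a \<xi> False))\<^sup>2 + (norm_l2 (mat_apply a \<xi> True))\<^sup>2
            \<le> (norm_l2 (\<xi> False))\<^sup>2 + (norm_l2 (\<xi> True))\<^sup>2)}"

definition Lset :: "'i op set \<Rightarrow> ('i op \<Rightarrow> real) \<Rightarrow> 'j op set \<Rightarrow> ('j op \<Rightarrow> real)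
                    \<Rightarrow> (('i op \<times> 'j op) \<Rightarrow> real) set" where
  "Lset M LM N LN = {L.
       (\<forall>x\<in>M. \<forall>y\<in>N. 0 \<le> L (x, y))
     \<and> (\<forall>a. \<forall>x\<in>M. \<forall>y\<in>N. L (op_scale a x, op_scale a y) = cmod a * L (x, y))
     \<and> (\<forall>x\<in>M. \<forall>y\<in>N. \<forall>x'\<in>M. \<forall>y'\<in>N.
          L (op_add x x', op_add y y') \<le> L (x, y) + L (x', y'))
     \<and> (\<forall>x\<in>M. L (x, op_zero) = LM x)
     \<and> (\<forall>y\<in>N. L (op_zero, y) = LN y)}"

definition Lmat :: "(('i op \<times> 'j op) \<Rightarrow> real) \<Rightarrow> 'i mat2 \<Rightarrow> 'j mat2 \<Rightarrow> real" where
  "Lmat L a b = Max {L (a i j, b i j) | i j. True}"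

definition mat_neg :: "'j mat2 \<Rightarrow> 'j mat2" where
  "mat_neg b = (\<lambda>i j. op_scale (-1) (b i j))"

definition distH :: "'i op set \<Rightarrow> 'j op set \<Rightarrow> (('i op \<times> 'j op) \<Rightarrow> real) \<Rightarrow> real" where
  "distH M N L = max
     (Sup ((\<lambda>x. Inf ((\<lambda>y. Lmat L x (mat_neg y)) ` X_set N)) ` X_set M))
     (Sup ((\<lambda>y. Inf ((\<lambda>x. Lmat L x (mat_neg y)) ` X_set M)) ` X_set N))"

definition dist_qGH :: "'i op set \<Rightarrow> ('i op \<Rightarrow> real) \<Rightarrow> 'j op set \<Rightarrow> ('j op \<Rightarrow> real) \<Rightarrow> real" where
  "dist_qGH M LM N LN = Inf (distH M N ` Lset M LM N LN)"

definition star_iso :: "'i op set \<Rightarrow> 'j op set \<Rightarrow> ('i op \<Rightarrow> 'j op) \<Rightarrow> bool" where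
  "star_iso M N \<phi> \<longleftrightarrow> bij_betw \<phi> M N
     \<and> (\<forall>x\<in>M. \<forall>y\<in>M. \<phi> (op_add x y) = op_add (\<phi> x) (\<phi> y)
                    \<and> \<phi> (op_comp x y) = op_comp (\<phi> x) (\<phi> y))
     \<and> (\<forall>a. \<forall>x\<in>M. \<phi> (op_scale a x) = op_scale a (\<phi> x))
     \<and> (\<forall>x\<in>M. \<phi> (adjoint x) = adjoint (\<phi> x))"

end

theory Submission
  imports Defs
begin

text \<open>Seminorms in \<open>Lset M LM N LN\<close> lie below \<open>LM x + LN y\<close>, so by Tychonoff a sequence of them with
  Hausdorff distance tending to 0 has a pointwise cluster point \<open>L\<close>. As the unit balls are compact, \<open>L\<close>
  has distance exactly 0: every \<open>x\<close> in \<open>X_set M\<close> has a partner \<open>y\<close> in \<open>X_set N\<close> with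
  \<open>L (x i j, - y i j) = 0\<close> in every entry, and vice versa. The relation \<open>L (x, - y) = 0\<close> is therefore the
  graph of a linear bijection \<open>\<phi>\<close> from \<open>M\<close> to \<open>N\<close> with \<open>LN (\<phi> x) = LM x\<close> that preserves positivity of
  2 by 2 matrices in both directions. It is unital because the identity is the largest positive
  contraction, and positivity of the matrix with rows \<open>1, x\<close> and \<open>x*, x*x\<close> gives the Kadison-Schwarz
  inequality for \<open>\<phi>\<close> and for its inverse, hence \<open>\<phi> (x*x) = \<phi>(x)* \<phi>(x)\<close>. Polarization makes \<open>\<phi>\<close>
  multiplicative.\<close>

subsection \<open>The Hilbert space\<close>

text \<open>Index sets and algebras are arbitrary, so subsequences cannot be relied on: limits are
  taken along filters finer than \<open>sequentially\<close>, with Tychonoff used once for the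
  seminorms and once more for the partners of a fixed matrix. The two limits fit together because
  every member of \<open>Lset\<close> restricts to the same \<open>LN\<close> on N, so the cost of
  replacing a partner by its limit does not depend on the seminorm. Tychonoff by itself gives only
  coordinatewise convergence. On bounded sets this is weak convergence, and the LvNA condition turns
  it into convergence in the Lip-norm. Order two is what the product needs: a unital order
  isomorphism of the algebras alone may fail to be multiplicative, as transposition of complex
  matrices shows, whereas a 2 by 2 matrix has room for 1, x, its adjoint and their product. That
  matrix is in general no contraction, so positivity has to be carried from \<open>X_set\<close> to
  the whole positive cone by rescaling.\<close>

lemma l2_zero [simp]: "(\<lambda>_. 0) \<in> l2"
  by (simp add: l2_def)

lemma l2_scale: "u \<in> l2 \<Longrightarrow> (\<lambda>i. a * u i) \<in> l2"
  unfolding l2_def by (auto simp: norm_mult power_mult_distrib intro: summable_on_cmult_right)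

lemma cmod_add_sq_le: "(cmod (a + b))\<^sup>2 \<le> 2 * (cmod a)\<^sup>2 + 2 * (cmod b)\<^sup>2"
proof -
  have "(cmod (a + b))\<^sup>2 \<le> (cmod a + cmod b)\<^sup>2"
    by (intro power_mono norm_triangle_ineq) auto
  also have "\<dots> \<le> 2 * (cmod a)\<^sup>2 + 2 * (cmod b)\<^sup>2"
    using sum_squares_bound[of "cmod a" "cmod b"] by (simp add: power2_sum)
  finally show ?thesis .
qed

lemma l2_add:
  assumes "u \<in> l2" "v \<in> l2"
  shows "(\<lambda>i. u i + v i) \<in> l2"
proof -
  have "(\<lambda>i. 2 * (cmod (u i))\<^sup>2 + 2 * (cmod (v i))\<^sup>2) summable_on UNIV"
    using assms unfolding l2_def by (auto intro!: summable_on_add summable_on_cmult_right)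
  then show ?thesis
    unfolding l2_def mem_Collect_eq
    by (rule summable_on_comparison_test) (auto intro: cmod_add_sq_le)
qed

lemma l2_diff: "u \<in> l2 \<Longrightarrow> v \<in> l2 \<Longrightarrow> (\<lambda>i. u i - v i) \<in> l2"
  using l2_add[of u "\<lambda>i. (-1) * v i"] l2_scale[of v "-1"] by simp

lemma inner_summable:
  assumes "u \<in> l2" "v \<in> l2"
  shows "(\<lambda>i. cnj (u i) * v i) summable_on UNIV"
proof -
  have "(\<lambda>i. (cmod (u i))\<^sup>2 + (cmod (v i))\<^sup>2) summable_on UNIV"
    using assms unfolding l2_def by (auto intro!: summable_on_add)
  then have "(\<lambda>i. norm (cnj (u i) * v i)) summable_on UNIV"
  proof (rule summable_on_comparison_test)
    show "norm (cnj (u i) * v i) \<le> (cmod (u i))\<^sup>2 + (cmod (v i))\<^sup>2" for i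
    proof -
      have "2 * (cmod (u i) * cmod (v i)) \<le> (cmod (u i))\<^sup>2 + (cmod (v i))\<^sup>2"
        using sum_squares_bound[of "cmod (u i)" "cmod (v i)"] by (simp add: mult.assoc)
      moreover have "0 \<le> cmod (u i) * cmod (v i)" by simp
      ultimately show ?thesis unfolding norm_mult complex_mod_cnj by linarith
    qed
  qed auto
  then show ?thesis by (rule abs_summable_summable)
qed

lemma inner_add_right:
  "u \<in> l2 \<Longrightarrow> v \<in> l2 \<Longrightarrow> w \<in> l2 \<Longrightarrow> inner_l2 u (\<lambda>i. v i + w i) = inner_l2 u v + inner_l2 u w"
  unfolding inner_l2_def
  by (simp add: distrib_left infsum_add inner_summable)

lemma inner_scale_right: "inner_l2 u (\<lambda>i. a * v i) = a * inner_l2 u v"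
  unfolding inner_l2_def infsum_cmult_right'[symmetric] by (simp add: mult_ac)

lemma inner_cnj: "cnj (inner_l2 u v) = inner_l2 v u"
  unfolding inner_l2_def infsum_cnj[symmetric] by (simp add: mult_ac)

lemma inner_add_left:
  "u \<in> l2 \<Longrightarrow> v \<in> l2 \<Longrightarrow> w \<in> l2 \<Longrightarrow> inner_l2 (\<lambda>i. v i + w i) u = inner_l2 v u + inner_l2 w u"
  using arg_cong[OF inner_add_right[of u v w], of cnj] by (simp add: inner_cnj)

lemma inner_scale_left: "inner_l2 (\<lambda>i. a * v i) u = cnj a * inner_l2 v u"
  using arg_cong[OF inner_scale_right[of u a v], of cnj] by (simp add: inner_cnj)

lemma inner_diff_right:
  "u \<in> l2 \<Longrightarrow> v \<in> l2 \<Longrightarrow> w \<in> l2 \<Longrightarrow> inner_l2 u (\<lambda>i. v i - w i) = inner_l2 u v - inner_l2 u w"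
  using inner_add_right[of u v "\<lambda>i. (-1) * w i"] inner_scale_right[of u "-1" w] l2_scale[of w "-1"] by simp

lemma inner_diff_left:
  "u \<in> l2 \<Longrightarrow> v \<in> l2 \<Longrightarrow> w \<in> l2 \<Longrightarrow> inner_l2 (\<lambda>i. v i - w i) u = inner_l2 v u - inner_l2 w u"
  using arg_cong[OF inner_diff_right[of u v w], of cnj] by (simp add: inner_cnj)

lemma inner_zero_right [simp]: "inner_l2 u (\<lambda>_. 0) = 0"
  by (simp add: inner_l2_def)

lemma inner_zero_left [simp]: "inner_l2 (\<lambda>_. 0) u = 0"
  by (simp add: inner_l2_def)

lemma norm_l2_nonneg [simp]: "0 \<le> norm_l2 u"
  by (simp add: norm_l2_def infsum_nonneg)

lemma norm_l2_sq: "(norm_l2 u)\<^sup>2 = infsum (\<lambda>i. (cmod (u i))\<^sup>2) UNIV"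
  by (simp add: norm_l2_def infsum_nonneg)

lemma norm_l2_zero [simp]: "norm_l2 (\<lambda>_. 0) = 0"
  by (simp add: norm_l2_def)

lemma inner_self: "u \<in> l2 \<Longrightarrow> inner_l2 u u = of_real ((norm_l2 u)\<^sup>2)"
proof -
  assume u: "u \<in> l2"
  have "((\<lambda>i. (cmod (u i))\<^sup>2) has_sum (norm_l2 u)\<^sup>2) UNIV"
    using u unfolding norm_l2_sq l2_def by (simp add: has_sum_infsum)
  then have "((\<lambda>i. complex_of_real ((cmod (u i))\<^sup>2)) has_sum of_real ((norm_l2 u)\<^sup>2)) UNIV"
    by (rule has_sum_of_real)
  moreover have "(\<lambda>i. complex_of_real ((cmod (u i))\<^sup>2)) = (\<lambda>i. cnj (u i) * u i)"
    by (simp add: complex_norm_square mult.commute del: of_real_power)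
  ultimately have "((\<lambda>i. cnj (u i) * u i) has_sum of_real ((norm_l2 u)\<^sup>2)) UNIV"
    by (simp only:)
  then show ?thesis unfolding inner_l2_def by (rule infsumI)
qed

lemma finite_sum_le_norm_sq:
  assumes "u \<in> l2" "finite F"
  shows "(\<Sum>i\<in>F. (cmod (u i))\<^sup>2) \<le> (norm_l2 u)\<^sup>2"
  unfolding norm_l2_sq using assms by (intro finite_sum_le_infsum) (auto simp: l2_def)

lemma coord_le_norm: "u \<in> l2 \<Longrightarrow> cmod (u i) \<le> norm_l2 u"
  using finite_sum_le_norm_sq[of u "{i}"] by (simp add: power2_le_iff_abs_le)

lemma norm_l2_eq_0: "u \<in> l2 \<Longrightarrow> norm_l2 u = 0 \<Longrightarrow> u = (\<lambda>_. 0)"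
  using coord_le_norm[of u] by auto

lemma norm_l2_scale: "norm_l2 (\<lambda>i. a * u i) = cmod a * norm_l2 u"
  by (simp add: norm_l2_def norm_mult power_mult_distrib infsum_cmult_right' real_sqrt_mult)

lemma l2_bounded_sums:
  assumes "\<And>F. finite F \<Longrightarrow> (\<Sum>i\<in>F. (cmod (u i))\<^sup>2) \<le> C\<^sup>2" "0 \<le> C"
  shows "u \<in> l2" "norm_l2 u \<le> C"
proof -
  show u: "u \<in> l2" unfolding l2_def mem_Collect_eq
    by (rule nonneg_bdd_above_summable_on) (auto intro!: bdd_aboveI2[where M = "C\<^sup>2"] assms)
  have "(norm_l2 u)\<^sup>2 \<le> C\<^sup>2"
    unfolding norm_l2_sq using u assms by (intro infsum_le_finite_sums) (auto simp: l2_def)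
  then show "norm_l2 u \<le> C" using assms(2) by (rule power2_le_imp_le)
qed

lemma norm_add_sq:
  assumes "u \<in> l2" "v \<in> l2"
  shows "(norm_l2 (\<lambda>i. u i + v i))\<^sup>2 = (norm_l2 u)\<^sup>2 + 2 * Re (inner_l2 u v) + (norm_l2 v)\<^sup>2"
proof -
  have "complex_of_real ((norm_l2 (\<lambda>i. u i + v i))\<^sup>2) =
     inner_l2 u u + inner_l2 u v + (cnj (inner_l2 u v) + inner_l2 v v)"
    using assms by (subst inner_self[symmetric]) (auto simp: inner_add_left inner_add_right inner_cnj l2_add)
  then have "Re (complex_of_real ((norm_l2 (\<lambda>i. u i + v i))\<^sup>2)) =
     Re (inner_l2 u u + inner_l2 u v + (cnj (inner_l2 u v) + inner_l2 v v))" by (rule arg_cong)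
  then show ?thesis using assms by (simp add: inner_self flip: of_real_power)
qed

text \<open>This is nonnegativity of the squared norm of u - v, expanded. Besides giving
  Cauchy-Schwarz after rescaling, it later supplies the weak lower semicontinuity of the norm in
  \<open>X_set_cluster\<close>.\<close>

lemma Re_inner_bound:
  assumes "u \<in> l2" "v \<in> l2"
  shows "2 * Re (inner_l2 u v) \<le> (norm_l2 u)\<^sup>2 + (norm_l2 v)\<^sup>2"
proof -
  have "0 \<le> (norm_l2 (\<lambda>i. u i + (-1) * v i))\<^sup>2" by simp
  also have "\<dots> = (norm_l2 u)\<^sup>2 - 2 * Re (inner_l2 u v) + (norm_l2 v)\<^sup>2"
    unfolding norm_add_sq[OF assms(1) l2_scale[OF assms(2)]] inner_scale_right norm_l2_scale by simp
  finally show ?thesis by simp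
qed

lemma norm_add_sq_le:
  assumes "u \<in> l2" "v \<in> l2"
  shows "(norm_l2 (\<lambda>i. u i + v i))\<^sup>2 \<le> 2 * (norm_l2 u)\<^sup>2 + 2 * (norm_l2 v)\<^sup>2"
  using norm_add_sq[OF assms] Re_inner_bound[OF assms] by simp

lemma cauchy_schwarz:
  assumes u: "u \<in> l2" and v: "v \<in> l2"
  shows "cmod (inner_l2 u v) \<le> norm_l2 u * norm_l2 v"
proof (cases "norm_l2 u = 0 \<or> norm_l2 v = 0 \<or> inner_l2 u v = 0")
  case True
  then show ?thesis using norm_l2_eq_0[OF u] norm_l2_eq_0[OF v] by auto
next
  case False
  define p where "p = norm_l2 u"
  define q where "q = norm_l2 v"
  define z where "z = inner_l2 u v"
  have pq: "p > 0" "q > 0" using False norm_l2_nonneg[of u] norm_l2_nonneg[of v] by (auto simp: p_def q_def less_le)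
  have z: "cmod z > 0" using False z_def by simp
  \<comment> \<open>rescale to unit vectors and rotate so that the inner product becomes positive\<close>
  define a where "a = z / (cmod z * p)"
  have ca: "cnj a * z = cmod z / p"
    using z pq by (simp add: a_def field_simps complex_norm_square power2_eq_square flip: of_real_mult)
       (simp add: complex_norm_square[symmetric] power2_eq_square mult.commute)
  have na: "cmod a = 1 / p" using z pq by (simp add: a_def norm_divide norm_mult)
  have "2 * Re (inner_l2 (\<lambda>i. a * u i) (\<lambda>i. complex_of_real (1 / q) * v i))
     \<le> (norm_l2 (\<lambda>i. a * u i))\<^sup>2 + (norm_l2 (\<lambda>i. complex_of_real (1 / q) * v i))\<^sup>2"
    by (intro Re_inner_bound l2_scale u v)
  also have "\<dots> = 2" using pq unfolding norm_l2_scale na by (simp add: p_def q_def norm_divide)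
  also have "inner_l2 (\<lambda>i. a * u i) (\<lambda>i. complex_of_real (1 / q) * v i) = (1 / q) * (cnj a * z)"
    unfolding inner_scale_left inner_scale_right z_def by (simp add: mult_ac)
  also have "\<dots> = complex_of_real (cmod z / (p * q))" unfolding ca by simp
  finally have "cmod z / (p * q) \<le> 1" by simp
  then show ?thesis using pq by (simp add: p_def q_def z_def field_simps)
qed

text \<open>Truncation also supplies the standard basis: \<open>restr {i} (\<lambda>_. 1)\<close> is
  the unit vector at i. For finite F the result lies in l2 even when u is not known to, which the
  Riesz argument exploits.\<close>

definition restr :: "'i set \<Rightarrow> 'i vec \<Rightarrow> 'i vec" where
  "restr F u = (\<lambda>i. if i \<in> F then u i else 0)"

lemma restr_l2:
  assumes "finite F"
  shows "restr F u \<in> l2" and "(norm_l2 (restr F u))\<^sup>2 = (\<Sum>i\<in>F. (cmod (u i))\<^sup>2)"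
proof -
  have *: "(\<lambda>i. (cmod (restr F u i))\<^sup>2) summable_on UNIV \<longleftrightarrow> (\<lambda>i. (cmod (u i))\<^sup>2) summable_on F"
    by (rule summable_on_cong_neutral) (auto simp: restr_def)
  then show "restr F u \<in> l2" using assms by (simp add: l2_def)
  have "infsum (\<lambda>i. (cmod (restr F u i))\<^sup>2) UNIV = infsum (\<lambda>i. (cmod (u i))\<^sup>2) F"
    by (rule infsum_cong_neutral) (auto simp: restr_def)
  then show "(norm_l2 (restr F u))\<^sup>2 = (\<Sum>i\<in>F. (cmod (u i))\<^sup>2)" using assms by (simp add: norm_l2_sq)
qed

lemma inner_restr:
  assumes "finite F"
  shows "inner_l2 (restr F u) w = (\<Sum>i\<in>F. cnj (u i) * w i)"
proof -
  have "inner_l2 (restr F u) w = infsum (\<lambda>i. cnj (u i) * w i) F"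
    unfolding inner_l2_def by (rule infsum_cong_neutral) (auto simp: restr_def)
  then show ?thesis using assms by simp
qed

lemma restr_approx:
  assumes u: "u \<in> l2" and e: "e > 0"
  obtains F where "finite F" "norm_l2 (\<lambda>i. u i - restr F u i) < e"
proof -
  let ?f = "\<lambda>i. (cmod (u i))\<^sup>2"
  have s: "?f summable_on UNIV" using u by (simp add: l2_def)
  \<comment> \<open>The approximation is available with a weak inequality; halving
    \<open>e\<^sup>2\<close> makes the final bound strict.\<close>
  then obtain F where F: "finite F" "dist (sum ?f F) (infsum ?f UNIV) \<le> e\<^sup>2 / 2"
    using infsum_finite_approximation[of ?f UNIV "e\<^sup>2 / 2"] e by auto
  have "(norm_l2 (\<lambda>i. u i - restr F u i))\<^sup>2 = infsum ?f (UNIV - F)"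
    unfolding norm_l2_sq by (rule infsum_cong_neutral) (auto simp: restr_def)
  also have "\<dots> = infsum ?f UNIV - sum ?f F" using s F(1) by (subst infsum_Diff) auto
  also have "\<dots> \<le> e\<^sup>2 / 2" using F(2) unfolding dist_real_def by linarith
  also have "\<dots> < e\<^sup>2" using e by simp
  finally have "norm_l2 (\<lambda>i. u i - restr F u i) < e" using e by (rule power2_less_imp_less[OF _ less_imp_le])
  with F(1) show thesis by (rule that)
qed

lemma inner_ext:
  assumes "v \<in> l2" "w \<in> l2" "\<And>u. u \<in> l2 \<Longrightarrow> inner_l2 u v = inner_l2 u w"
  shows "v = w"
proof
  fix i
  show "v i = w i"
    using assms(3)[OF restr_l2(1)[of "{i}" "\<lambda>_. 1"]] by (simp add: inner_restr)
qed

subsection \<open>Riesz representation and adjoints\<close>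

text \<open>The values of h on basis vectors force the representing vector s. Evaluating h at
  truncations of s bounds the partial sums and puts s into l2. Agreement on finitely supported
  vectors then extends by density, as both sides are bounded.\<close>

lemma riesz_representation:
  assumes lin: "\<And>u v a b. u \<in> l2 \<Longrightarrow> v \<in> l2 \<Longrightarrow> h (\<lambda>i. a * u i + b * v i) = a * h u + b * h v"
    and bd: "\<And>u. u \<in> l2 \<Longrightarrow> cmod (h u) \<le> C * norm_l2 u" and C: "0 \<le> C"
  shows "\<exists>s\<in>l2. \<forall>w\<in>l2. h w = inner_l2 s w"
proof -
  define s where "s i = cnj (h (restr {i} (\<lambda>_. 1)))" for i
  have h0: "h (\<lambda>_. 0) = 0" using bd[of "\<lambda>_. 0"] by simp
  have fin: "h (restr F w) = (\<Sum>i\<in>F. cnj (s i) * w i)" if "finite F" for F w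
    using that
  proof (induction F)
    case empty
    show ?case using h0 by (simp add: restr_def)
  next
    case (insert x F)
    have "restr (insert x F) w = (\<lambda>i. w x * restr {x} (\<lambda>_. 1) i + 1 * restr F w i)"
      using insert by (auto simp: restr_def)
    then have "h (restr (insert x F) w) = w x * h (restr {x} (\<lambda>_. 1)) + 1 * h (restr F w)"
      using insert by (simp only: lin restr_l2 finite.intros)
    then show ?case using insert by (simp add: s_def)
  qed
  have sums: "(\<Sum>i\<in>F. (cmod (s i))\<^sup>2) \<le> C\<^sup>2" if F: "finite F" for F
  proof -
    define q where "q = norm_l2 (restr F s)"
    have q2: "q\<^sup>2 = (\<Sum>i\<in>F. (cmod (s i))\<^sup>2)" unfolding q_def using F by (rule restr_l2)
    have "h (restr F s) = of_real (q\<^sup>2)"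
      unfolding q2 using F by (simp add: fin complex_norm_square mult.commute del: of_real_power)
    then have "q\<^sup>2 \<le> C * q" using bd[OF restr_l2(1)[OF F, of s]] by (simp add: q_def norm_power)
    then have "q \<le> C" using C norm_l2_nonneg[of "restr F s"] unfolding q_def[symmetric]
      by (cases "q = 0") (auto simp: power2_eq_square)
    then show ?thesis unfolding q2[symmetric] by (intro power_mono) (auto simp: q_def)
  qed
  have s: "s \<in> l2" by (rule l2_bounded_sums(1)[OF sums C])
  have "h w = inner_l2 s w" if w: "w \<in> l2" for w
  proof (rule ccontr)
    assume ne: "h w \<noteq> inner_l2 s w"
    \<comment> \<open>D dominates the bounds of h and of the inner product with s together; the
      added 1 makes it positive, so that it can be divided by.\<close>
    define D where "D = C + norm_l2 s + 1"
    have D: "D > 0" using C norm_l2_nonneg[of s] unfolding D_def by linarith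
    obtain F where F: "finite F" "norm_l2 (\<lambda>i. w i - restr F w i) < cmod (h w - inner_l2 s w) / D"
      using restr_approx[OF w, of "cmod (h w - inner_l2 s w) / D"] ne D by auto
    let ?d = "\<lambda>i. w i - restr F w i"
    have d: "?d \<in> l2" by (intro l2_diff w restr_l2(1) F(1))
    have 1: "h ?d = h w - h (restr F w)"
      using lin[OF w restr_l2(1)[OF F(1), of w], of 1 "-1"] by simp
    have 2: "inner_l2 s ?d = inner_l2 s w - inner_l2 s (restr F w)"
      using s w F restr_l2(1) by (intro inner_diff_right) auto
    have "inner_l2 s (restr F w) = cnj (inner_l2 (restr F w) s)" by (simp add: inner_cnj)
    also have "\<dots> = h (restr F w)" using F by (simp add: inner_restr fin mult.commute)
    finally have "h w - inner_l2 s w = h ?d - inner_l2 s ?d" using 1 2 by simp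
    then have "cmod (h w - inner_l2 s w) \<le> cmod (h ?d) + cmod (inner_l2 s ?d)"
      by (metis norm_triangle_ineq4)
    also have "\<dots> \<le> C * norm_l2 ?d + norm_l2 s * norm_l2 ?d"
      by (intro add_mono bd cauchy_schwarz d s)
    also have "\<dots> \<le> D * norm_l2 ?d" by (simp add: D_def algebra_simps)
    also have "\<dots> < cmod (h w - inner_l2 s w)" using F(2) D by (simp add: field_simps)
    finally show False by simp
  qed
  with s show ?thesis by blast
qed

section \<open>Bounded operators and their adjoints\<close>

lemma bopD:
  assumes "T \<in> bop"
  shows "v \<in> l2 \<Longrightarrow> T v \<in> l2"
    and "u \<in> l2 \<Longrightarrow> v \<in> l2 \<Longrightarrow> T (\<lambda>i. a * u i + b * v i) = (\<lambda>i. a * T u i + b * T v i)"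
    and "v \<notin> l2 \<Longrightarrow> T v = (\<lambda>_. 0)"
  using assms by (auto simp: bop_def)

lemma bop_add: "T \<in> bop \<Longrightarrow> u \<in> l2 \<Longrightarrow> v \<in> l2 \<Longrightarrow> T (\<lambda>i. u i + v i) = (\<lambda>i. T u i + T v i)"
  using bopD(2)[of T u v 1 1] by simp

lemma bop_scale: "T \<in> bop \<Longrightarrow> u \<in> l2 \<Longrightarrow> T (\<lambda>i. a * u i) = (\<lambda>i. a * T u i)"
  using bopD(2)[of T u u a 0] by simp

lemma bop_zero_vec: "T \<in> bop \<Longrightarrow> T (\<lambda>_. 0) = (\<lambda>_. 0)"
  using bop_scale[of T "\<lambda>_. 0" 0] by simp

lemma bop_bound:
  assumes "T \<in> bop"
  shows "\<exists>C>0. \<forall>v\<in>l2. norm_l2 (T v) \<le> C * norm_l2 v"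
proof -
  obtain C where C: "\<forall>v\<in>l2. norm_l2 (T v) \<le> C * norm_l2 v" using assms unfolding bop_def mem_Collect_eq by (elim conjE exE)
  have "norm_l2 (T v) \<le> (\<bar>C\<bar> + 1) * norm_l2 v" if v: "v \<in> l2" for v
  proof -
    have "C * norm_l2 v \<le> (\<bar>C\<bar> + 1) * norm_l2 v" by (intro mult_right_mono) auto
    with C v show ?thesis by fastforce
  qed
  moreover have "\<bar>C\<bar> + 1 > 0" by simp
  ultimately show ?thesis by blast
qed

lemma bopI:
  assumes "\<And>v. v \<in> l2 \<Longrightarrow> T v \<in> l2"
    and "\<And>u v a b. u \<in> l2 \<Longrightarrow> v \<in> l2 \<Longrightarrow> T (\<lambda>i. a * u i + b * v i) = (\<lambda>i. a * T u i + b * T v i)"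
    and "\<And>v. v \<in> l2 \<Longrightarrow> norm_l2 (T v) \<le> C * norm_l2 v"
    and "\<And>v. v \<notin> l2 \<Longrightarrow> T v = (\<lambda>_. 0)"
  shows "T \<in> bop"
  unfolding bop_def mem_Collect_eq
  by (intro conjI ballI allI exI[of _ C] impI assms)

lemma bop_ext:
  assumes "S \<in> bop" "T \<in> bop" "\<And>u v. u \<in> l2 \<Longrightarrow> v \<in> l2 \<Longrightarrow> inner_l2 u (S v) = inner_l2 u (T v)"
  shows "S = T"
proof
  fix v show "S v = T v"
    using assms by (cases "v \<in> l2") (auto intro: inner_ext simp: bopD)
qed

text \<open>Riesz is applied to the functional sending w to \<open>inner_l2 v (T w)\<close>; its
  representing vector is the value at v. Outside l2 the value is zero, as \<open>bop\<close>
  demands. The bound follows from the identity of \<open>inner_l2 (T (S v)) v\<close> with the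
  squared norm of \<open>S v\<close>, after cancelling one factor.\<close>

lemma adjoint_exists:
  assumes T: "T \<in> bop"
  shows "\<exists>S\<in>bop. \<forall>u\<in>l2. \<forall>v\<in>l2. inner_l2 (T u) v = inner_l2 u (S v)"
proof -
  obtain C where C0: "C > 0" "\<forall>v\<in>l2. norm_l2 (T v) \<le> C * norm_l2 v" using bop_bound[OF T] by (elim exE conjE)
  have C: "C > 0" "\<And>v. v \<in> l2 \<Longrightarrow> norm_l2 (T v) \<le> C * norm_l2 v" using C0 by auto
  have "\<exists>s\<in>l2. \<forall>w\<in>l2. inner_l2 v (T w) = inner_l2 s w" if v: "v \<in> l2" for v
  proof (rule riesz_representation[where C = "norm_l2 v * C"])
    show "inner_l2 v (T (\<lambda>i. a * x i + b * y i)) = a * inner_l2 v (T x) + b * inner_l2 v (T y)"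
      if "x \<in> l2" "y \<in> l2" for x y a b
      using that T v by (simp add: bopD inner_add_right inner_scale_right l2_scale)
    show "cmod (inner_l2 v (T x)) \<le> norm_l2 v * C * norm_l2 x" if "x \<in> l2" for x
      using cauchy_schwarz[OF v bopD(1)[OF T that]] mult_left_mono[OF C(2)[OF that], of "norm_l2 v"] by simp
  qed (use C in auto)
  then have "\<forall>v\<in>l2. \<exists>s. s \<in> l2 \<and> (\<forall>w\<in>l2. inner_l2 v (T w) = inner_l2 s w)" by auto
  from bchoice[OF this] obtain s where s: "\<forall>v\<in>l2. s v \<in> l2 \<and> (\<forall>w\<in>l2. inner_l2 v (T w) = inner_l2 (s v) w)"
    by auto
  define S where "S v = (if v \<in> l2 then s v else (\<lambda>_. 0))" for v
  have S: "S v \<in> l2" "inner_l2 (T w) v = inner_l2 w (S v)" if "v \<in> l2" "w \<in> l2" for v w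
  proof -
    show "S v \<in> l2" using s that by (simp add: S_def)
    have "inner_l2 v (T w) = inner_l2 (S v) w" using s that by (simp add: S_def)
    then have "cnj (inner_l2 v (T w)) = cnj (inner_l2 (S v) w)" by simp
    then show "inner_l2 (T w) v = inner_l2 w (S v)" by (simp add: inner_cnj)
  qed
  have "S \<in> bop"
  proof (rule bopI)
    show "S v \<in> l2" if "v \<in> l2" for v by (rule S(1)[OF that l2_zero])
    show "S (\<lambda>i. a * u i + b * v i) = (\<lambda>i. a * S u i + b * S v i)" if "u \<in> l2" "v \<in> l2" for u v a b
    proof (rule inner_ext)
      fix w :: "'a vec" assume w: "w \<in> l2"
      have "inner_l2 w (S (\<lambda>i. a * u i + b * v i)) = inner_l2 (T w) (\<lambda>i. a * u i + b * v i)"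
        using that w by (intro S(2)[symmetric] l2_add l2_scale)
      also have "\<dots> = a * inner_l2 w (S u) + b * inner_l2 w (S v)"
        using that w T by (simp add: inner_add_right inner_scale_right l2_scale bopD S(2))
      also have "\<dots> = inner_l2 w (\<lambda>i. a * S u i + b * S v i)"
        using that w T S by (simp add: inner_add_right inner_scale_right l2_scale)
      finally show "inner_l2 w (S (\<lambda>i. a * u i + b * v i)) = inner_l2 w (\<lambda>i. a * S u i + b * S v i)" .
    qed (intro S(1)[where w = "\<lambda>_. 0"] l2_add l2_scale that l2_zero)+
    show "norm_l2 (S v) \<le> C * norm_l2 v" if v: "v \<in> l2" for v
    proof (cases "norm_l2 (S v) = 0")
      case False
      have Sv: "S v \<in> l2" by (rule S(1)[OF v l2_zero])
      have "complex_of_real ((norm_l2 (S v))\<^sup>2) = inner_l2 (T (S v)) v"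
        using inner_self[OF Sv] S(2)[OF v Sv] by simp
      then have "(norm_l2 (S v))\<^sup>2 \<le> norm_l2 (T (S v)) * norm_l2 v"
        using cauchy_schwarz[OF bopD(1)[OF T Sv] v] by (metis norm_of_real abs_power2)
      also have "\<dots> \<le> C * norm_l2 (S v) * norm_l2 v" by (intro mult_right_mono C Sv) auto
      finally show ?thesis using False norm_l2_nonneg[of "S v"] by (simp add: power2_eq_square less_le)
    qed (use C in simp)
  qed (simp add: S_def)
  with S(2) show ?thesis by auto
qed

text \<open>Uniqueness makes the definite description in \<open>adjoint\<close> computable: later
  adjoints are identified by exhibiting a candidate.\<close>

lemma adjoint_eqI:
  assumes "S \<in> bop" "\<And>u v. u \<in> l2 \<Longrightarrow> v \<in> l2 \<Longrightarrow> inner_l2 (T u) v = inner_l2 u (S v)"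
  shows "adjoint T = S"
  unfolding adjoint_def
proof (rule the_equality)
  fix S' assume "S' \<in> bop \<and> (\<forall>u\<in>l2. \<forall>v\<in>l2. inner_l2 (T u) v = inner_l2 u (S' v))"
  then show "S' = S" using assms by (intro bop_ext) auto
qed (use assms in auto)

lemma
  assumes "T \<in> bop"
  shows adjoint_bop: "adjoint T \<in> bop"
    and adjoint_inner: "u \<in> l2 \<Longrightarrow> v \<in> l2 \<Longrightarrow> inner_l2 u (adjoint T v) = inner_l2 (T u) v"
  proof -
  obtain S where S: "S \<in> bop" "\<And>u v. u \<in> l2 \<Longrightarrow> v \<in> l2 \<Longrightarrow> inner_l2 (T u) v = inner_l2 u (S v)"
    using adjoint_exists[OF assms] by blast
  then have "adjoint T = S" by (rule adjoint_eqI)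
  with S show "adjoint T \<in> bop" "u \<in> l2 \<Longrightarrow> v \<in> l2 \<Longrightarrow> inner_l2 u (adjoint T v) = inner_l2 (T u) v" by auto
qed

lemma adjoint_adjoint:
  assumes "T \<in> bop"
  shows "adjoint (adjoint T) = T"
proof (rule adjoint_eqI[OF assms])
  fix u v :: "'a vec" assume "u \<in> l2" "v \<in> l2"
  then show "inner_l2 (adjoint T u) v = inner_l2 u (T v)"
    using arg_cong[OF adjoint_inner[OF assms, of v u], of cnj] by (simp add: inner_cnj)
qed

subsection \<open>Positive operator matrices\<close>

text \<open>The quadratic form of a matrix on the direct sum of two copies of l2, at (u, v). It is
  kept as four inner products because each passes to weak limits separately.\<close>

definition qform :: "'i mat2 \<Rightarrow> 'i vec \<Rightarrow> 'i vec \<Rightarrow> complex" where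
  "qform a u v = inner_l2 u (a False False u) + inner_l2 u (a False True v)
     + inner_l2 v (a True False u) + inner_l2 v (a True True v)"

text \<open>Separated from the contraction condition of \<open>X_set\<close> because the matrix
  behind the Schwarz inequality is positive but in general no contraction.\<close>

definition mat_pos :: "'i op set \<Rightarrow> 'i mat2 \<Rightarrow> bool" where
  "mat_pos M a \<longleftrightarrow> (\<forall>i j. a i j \<in> M)
     \<and> (\<forall>u\<in>l2. \<forall>v\<in>l2. 0 \<le> Re (qform a u v) \<and> Im (qform a u v) = 0)"

definition mat_contr :: "'i mat2 \<Rightarrow> bool" where
  "mat_contr a \<longleftrightarrow> (\<forall>u\<in>l2. \<forall>v\<in>l2.
     (norm_l2 (\<lambda>k. a False False u k + a False True v k))\<^sup>2
      + (norm_l2 (\<lambda>k. a True False u k + a True True v k))\<^sup>2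
     \<le> (norm_l2 u)\<^sup>2 + (norm_l2 v)\<^sup>2)"

text \<open>Contractivity is stated vector by vector so that it survives limits without the supremum
  in \<open>op_norm\<close>; \<open>op_norm_le_1\<close> links the two.\<close>

definition opball :: "'i op set \<Rightarrow> 'i op set" where
  "opball M = {x \<in> M. \<forall>v\<in>l2. norm_l2 (x v) \<le> norm_l2 v}"

lemma all_bool_vec:
  "(\<forall>\<xi>::bool \<Rightarrow> 'i vec. (\<forall>i. \<xi> i \<in> l2) \<longrightarrow> P (\<xi> False) (\<xi> True)) \<longleftrightarrow> (\<forall>u\<in>l2. \<forall>v\<in>l2. P u v)"
proof safe
  fix u v :: "'i vec"
  assume *: "\<forall>\<xi>::bool \<Rightarrow> 'i vec. (\<forall>i. \<xi> i \<in> l2) \<longrightarrow> P (\<xi> False) (\<xi> True)" and "u \<in> l2" "v \<in> l2"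
  then show "P u v" using spec[OF *, of "\<lambda>b. if b then v else u"] by simp
qed simp

lemma X_set_iff:
  assumes "M \<subseteq> bop"
  shows "a \<in> X_set M \<longleftrightarrow> mat_pos M a \<and> mat_contr a"
proof (cases "\<forall>i j. a i j \<in> M")
  case True
  then have bop: "a i j \<in> bop" for i j using assms by blast
  have q: "inner_l2 u (\<lambda>k. a False False u k + a False True v k)
    + inner_l2 v (\<lambda>k. a True False u k + a True True v k) = qform a u v" if "u \<in> l2" "v \<in> l2" for u v
    using that by (simp add: inner_add_right qform_def bopD(1)[OF bop])
  have "(\<forall>\<xi>. (\<forall>i. \<xi> i \<in> l2) \<longrightarrow>
          (let z = inner_l2 (\<xi> False) (mat_apply a \<xi> False) + inner_l2 (\<xi> True) (mat_apply a \<xi> True)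
           in 0 \<le> Re z \<and> Im z = 0)) \<longleftrightarrow> (\<forall>u\<in>l2. \<forall>v\<in>l2. 0 \<le> Re (qform a u v) \<and> Im (qform a u v) = 0)"
    unfolding mat_apply_def all_bool_vec[where P = "\<lambda>u v. let z = inner_l2 u (\<lambda>k. a False False u k + a False True v k)
    + inner_l2 v (\<lambda>k. a True False u k + a True True v k) in 0 \<le> Re z \<and> Im z = 0"]
    by (simp add: q Let_def del: plus_complex.sel)
  moreover have "(\<forall>\<xi>. (\<forall>i. \<xi> i \<in> l2) \<longrightarrow>
          (norm_l2 (mat_apply a \<xi> False))\<^sup>2 + (norm_l2 (mat_apply a \<xi> True))\<^sup>2
            \<le> (norm_l2 (\<xi> False))\<^sup>2 + (norm_l2 (\<xi> True))\<^sup>2) \<longleftrightarrow> mat_contr a"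
    unfolding mat_apply_def mat_contr_def all_bool_vec[where P = "\<lambda>u v. (norm_l2 (\<lambda>k. a False False u k + a False True v k))\<^sup>2
      + (norm_l2 (\<lambda>k. a True False u k + a True True v k))\<^sup>2
     \<le> (norm_l2 u)\<^sup>2 + (norm_l2 v)\<^sup>2"] by (rule refl)
  ultimately show ?thesis unfolding X_set_def mat_pos_def using True by simp
next
  case False
  then show ?thesis unfolding X_set_def mat_pos_def by blast
qed

text \<open>A vector with one zero coordinate isolates a column of the contraction, and each entry
  of a column is bounded by the whole column.\<close>

lemma X_set_entry:
  assumes "M \<subseteq> bop" "a \<in> X_set M"
  shows "a i j \<in> opball M"
proof -
  have M: "a i j \<in> M" for i j using assms(2) by (simp add: X_set_def)
  then have bop: "a i j \<in> bop" for i j using assms(1) by blast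
  have c: "mat_contr a" using assms by (simp add: X_set_iff)
  have "norm_l2 (a i j w) \<le> norm_l2 w" if w: "w \<in> l2" for w
  proof -
    have "(norm_l2 (a i j w))\<^sup>2 \<le> (norm_l2 w)\<^sup>2"
    proof (cases j)
      case False
      have "(norm_l2 (a False False w))\<^sup>2 + (norm_l2 (a True False w))\<^sup>2 \<le> (norm_l2 w)\<^sup>2"
        using bspec[OF bspec[OF c[unfolded mat_contr_def] w] l2_zero] by (simp add: bop_zero_vec[OF bop])
      then have "(norm_l2 (a False False w))\<^sup>2 \<le> (norm_l2 w)\<^sup>2" "(norm_l2 (a True False w))\<^sup>2 \<le> (norm_l2 w)\<^sup>2"
        using zero_le_power2[of "norm_l2 (a False False w)"] zero_le_power2[of "norm_l2 (a True False w)"]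
        by linarith+
      then show ?thesis using False by (cases i) auto
    next
      case True
      have "(norm_l2 (a False True w))\<^sup>2 + (norm_l2 (a True True w))\<^sup>2 \<le> (norm_l2 w)\<^sup>2"
        using bspec[OF bspec[OF c[unfolded mat_contr_def] l2_zero] w] by (simp add: bop_zero_vec[OF bop])
      then have "(norm_l2 (a False True w))\<^sup>2 \<le> (norm_l2 w)\<^sup>2" "(norm_l2 (a True True w))\<^sup>2 \<le> (norm_l2 w)\<^sup>2"
        using zero_le_power2[of "norm_l2 (a False True w)"] zero_le_power2[of "norm_l2 (a True True w)"]
        by linarith+
      then show ?thesis using True by (cases i) auto
    qed
    then show ?thesis by (rule power2_le_imp_le) simp
  qed
  with M show ?thesis by (simp add: opball_def)
qed

subsection \<open>Compactness of the unit ball\<close>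

text \<open>Tychonoff in a form that can be iterated, once per argument of a nested function such as
  an operator matrix.\<close>

lemma compact_all_coords:
  fixes S :: "'a \<Rightarrow> 'b::topological_space set"
  assumes "\<And>i. compact (S i)"
  shows "compact {f. \<forall>i. f i \<in> S i}"
proof -
  have "compactin (product_topology (\<lambda>_. euclidean) UNIV) (PiE UNIV S)"
    using assms by (simp add: compactin_PiE)
  then show ?thesis by (simp add: euclidean_product_topology PiE_def Pi_def)
qed

text \<open>Refining F by the preimages of the neighbourhoods of a cluster point turns that point
  into a genuine limit. A filter takes the place of a subsequence, since the products used here may
  be uncountable.\<close>

lemma compact_cluster:
  assumes "compact U" "F \<noteq> bot" "\<forall>\<^sub>F n in F. g n \<in> U"
  obtains x H where "x \<in> U" "H \<noteq> bot" "H \<le> F" "(g \<longlongrightarrow> x) H"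
proof -
  have "filtermap g F \<noteq> bot" "\<forall>\<^sub>F y in filtermap g F. y \<in> U"
    using assms by (auto simp: filtermap_bot_iff eventually_filtermap)
  then obtain x where x: "x \<in> U" "inf (nhds x) (filtermap g F) \<noteq> bot"
    using assms(1) unfolding compact_filter by meson
  define H where "H = inf F (filtercomap g (nhds x))"
  have "H \<noteq> bot"
  proof
    assume "H = bot"
    then have "eventually (\<lambda>_. False) H" by simp
    then obtain P Q where PQ: "eventually P F" "eventually Q (filtercomap g (nhds x))" "\<And>n. P n \<Longrightarrow> Q n \<Longrightarrow> False"
      unfolding H_def eventually_inf by auto
    obtain R where R: "eventually R (nhds x)" "\<And>n. R (g n) \<Longrightarrow> Q n"
      using PQ(2) unfolding eventually_filtercomap by auto
    have "\<forall>\<^sub>F n in F. \<not> R (g n)" using PQ(1) by (rule eventually_mono) (use PQ(3) R(2) in blast)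
    then have "\<forall>\<^sub>F y in filtermap g F. \<not> R y" by (simp add: eventually_filtermap)
    then have "eventually (\<lambda>_. False) (inf (nhds x) (filtermap g F))"
      unfolding eventually_inf using R(1) by blast
    then show False using x(2) by (simp add: eventually_False)
  qed
  moreover have "H \<le> F" by (simp add: H_def)
  moreover have "(g \<longlongrightarrow> x) H"
    unfolding H_def filterlim_def by (meson filtermap_filtercomap filtermap_mono inf_le2 order_trans)
  ultimately show thesis using that[OF x(1)] by simp
qed

section \<open>Weak convergence and weak compactness of the matrix sets\<close>

lemma tendsto_coord:
  fixes f :: "'n \<Rightarrow> 'a \<Rightarrow> 'b::topological_space"
  assumes "(f \<longlongrightarrow> l) H"
  shows "((\<lambda>n. f n i) \<longlongrightarrow> l i) H"
proof (rule topological_tendstoI)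
  fix S :: "'b set" assume S: "open S" "l i \<in> S"
  have "open ((\<lambda>x::'a \<Rightarrow> 'b. x i) -` S)"
    using S(1) continuous_on_product_coordinates[of i] by (rule open_vimage)
  then have "\<forall>\<^sub>F n in H. f n \<in> (\<lambda>x. x i) -` S" using assms S(2) by (intro topological_tendstoD) auto
  then show "\<forall>\<^sub>F n in H. f n i \<in> S" by simp
qed

text \<open>Truncating u makes the inner product a finite sum, which converges coordinatewise; the
  norm bound and Cauchy-Schwarz control the tail uniformly.\<close>

lemma weak_tendsto:
  assumes coords: "\<And>i. ((\<lambda>n. w n i) \<longlongrightarrow> w0 i) H"
    and bd: "\<forall>\<^sub>F n in H. w n \<in> l2 \<and> norm_l2 (w n) \<le> C"
    and w0: "w0 \<in> l2" and u: "u \<in> l2"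
  shows "((\<lambda>n. inner_l2 u (w n)) \<longlongrightarrow> inner_l2 u w0) H"
proof (rule tendstoI)
  fix e :: real assume e: "e > 0"
  \<comment> \<open>D eventually bounds the sum of the norms of \<open>w n\<close> and
    \<open>w0\<close>, so the tail of u contributes less than e / 2.\<close>
  define D where "D = \<bar>C\<bar> + norm_l2 w0 + 1"
  have D: "D > 0" using norm_l2_nonneg[of w0] unfolding D_def by linarith
  obtain F where F: "finite F" "norm_l2 (\<lambda>i. u i - restr F u i) < e / (2 * D)"
    using restr_approx[OF u, of "e / (2 * D)"] e D by auto
  let ?d = "\<lambda>i. u i - restr F u i"
  have d: "?d \<in> l2" by (intro l2_diff u restr_l2(1) F)
  have "((\<lambda>n. inner_l2 (restr F u) (w n)) \<longlongrightarrow> inner_l2 (restr F u) w0) H"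
    unfolding inner_restr[OF F(1)] by (intro tendsto_intros coords)
  then have "\<forall>\<^sub>F n in H. dist (inner_l2 (restr F u) (w n)) (inner_l2 (restr F u) w0) < e / 2"
    using e by (intro tendstoD) auto
  with bd show "\<forall>\<^sub>F n in H. dist (inner_l2 u (w n)) (inner_l2 u w0) < e"
  proof eventually_elim
    case (elim n)
    then have wn: "w n \<in> l2" "norm_l2 (w n) \<le> C" by auto
    have split: "inner_l2 u w = inner_l2 (restr F u) w + inner_l2 ?d w" if "w \<in> l2" for w
      using that u F by (simp add: inner_diff_left restr_l2)
    have "inner_l2 u (w n) - inner_l2 u w0 = (inner_l2 (restr F u) (w n) - inner_l2 (restr F u) w0)
        + (inner_l2 ?d (w n) - inner_l2 ?d w0)"
      using split[OF wn(1)] split[OF w0] by simp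
    then have "cmod (inner_l2 u (w n) - inner_l2 u w0) \<le> cmod (inner_l2 (restr F u) (w n) - inner_l2 (restr F u) w0)
        + cmod (inner_l2 ?d (w n) - inner_l2 ?d w0)" by (metis norm_triangle_ineq)
    also have "cmod (inner_l2 ?d (w n) - inner_l2 ?d w0) \<le> cmod (inner_l2 ?d (w n)) + cmod (inner_l2 ?d w0)"
      by (rule norm_triangle_ineq4)
    also have "\<dots> \<le> norm_l2 ?d * norm_l2 (w n) + norm_l2 ?d * norm_l2 w0"
      by (intro add_mono cauchy_schwarz d wn w0)
    also have "\<dots> \<le> norm_l2 ?d * D"
      using wn(2) mult_left_mono[of "norm_l2 (w n)" "\<bar>C\<bar> + 1" "norm_l2 ?d"]
      unfolding D_def by (simp add: algebra_simps)
    also have "\<dots> < e / 2" using F(2) D by (simp add: field_simps)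
    finally show ?case using elim(2) by (simp add: dist_norm)
  qed
qed

lemma von_neumann_bop: "von_neumann_algebra M \<Longrightarrow> M \<subseteq> bop"
  by (simp add: von_neumann_algebra_def)

text \<open>The norm bound is inherited through finite partial sums, linearity coordinate by
  coordinate. Membership in M comes from the bicommutant condition: the limit still commutes with
  the commutant, because bounded operators respect weak convergence.\<close>

lemma opball_limit:
  fixes M :: "'i op set"
  assumes vN: "von_neumann_algebra M" and H: "H \<noteq> bot"
    and ev: "\<forall>\<^sub>F n in H. y n \<in> opball M"
    and coords: "\<And>v i. ((\<lambda>n. y n v i) \<longlongrightarrow> T v i) H"
  shows "T \<in> opball M"
proof -
  have evb: "\<forall>\<^sub>F n in H. y n \<in> bop" and evM: "\<forall>\<^sub>F n in H. y n \<in> M"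
    using ev by (auto elim!: eventually_mono simp: opball_def dest: subsetD[OF von_neumann_bop[OF vN]])
  have evc: "\<forall>\<^sub>F n in H. y n v \<in> l2 \<and> norm_l2 (y n v) \<le> norm_l2 v" if "v \<in> l2" for v
    using evb ev by eventually_elim (use that in \<open>auto simp: opball_def bopD\<close>)
  have sums: "(\<Sum>i\<in>F. (cmod (T v i))\<^sup>2) \<le> (norm_l2 v)\<^sup>2" if v: "v \<in> l2" and F: "finite F" for v F
  proof (rule tendsto_upperbound[OF _ _ H])
    show "((\<lambda>n. \<Sum>i\<in>F. (cmod (y n v i))\<^sup>2) \<longlongrightarrow> (\<Sum>i\<in>F. (cmod (T v i))\<^sup>2)) H"
      by (intro tendsto_intros coords)
    show "\<forall>\<^sub>F n in H. (\<Sum>i\<in>F. (cmod (y n v i))\<^sup>2) \<le> (norm_l2 v)\<^sup>2"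
      using evc[OF v]
    proof eventually_elim
      case (elim n)
      then show ?case using finite_sum_le_norm_sq[of "y n v" F] F
        by (meson norm_l2_nonneg order_trans power_mono)
    qed
  qed
  have T: "T v \<in> l2" "norm_l2 (T v) \<le> norm_l2 v" if "v \<in> l2" for v
    using l2_bounded_sums[OF sums[OF that] norm_l2_nonneg] by auto
  have T0: "T v = (\<lambda>_. 0)" if v: "v \<notin> l2" for v
  proof
    fix i
    have "((\<lambda>n. y n v i) \<longlongrightarrow> 0) H"
      by (rule tendsto_eventually) (use evb in \<open>auto elim!: eventually_mono simp: bopD v\<close>)
    then show "T v i = 0" using tendsto_unique[OF H coords] by blast
  qed
  have bop: "T \<in> bop"
  proof (rule bopI[where C = 1])
    fix u v :: "'i vec" and a b assume uv: "u \<in> l2" "v \<in> l2"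
    show "T (\<lambda>i. a * u i + b * v i) = (\<lambda>i. a * T u i + b * T v i)"
    proof
      fix i
      have "((\<lambda>n. a * y n u i + b * y n v i) \<longlongrightarrow> a * T u i + b * T v i) H"
        by (intro tendsto_intros coords)
      moreover have "\<forall>\<^sub>F n in H. a * y n u i + b * y n v i = y n (\<lambda>i. a * u i + b * v i) i"
        using evb by (rule eventually_mono) (simp add: bopD uv)
      ultimately have "((\<lambda>n. y n (\<lambda>i. a * u i + b * v i) i) \<longlongrightarrow> a * T u i + b * T v i) H"
        by (rule Lim_transform_eventually)
      then show "T (\<lambda>i. a * u i + b * v i) i = a * T u i + b * T v i"
        by (rule tendsto_unique[OF H coords])
    qed
  qed (use T T0 in auto)
  have "op_comp T S = op_comp S T" if S: "S \<in> commutant M" for S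
  proof
    fix v
    have Sb: "S \<in> bop" and comm: "\<And>x. x \<in> M \<Longrightarrow> op_comp S x = op_comp x S" using S by (auto simp: commutant_def)
    show "op_comp T S v = op_comp S T v"
    proof (cases "v \<in> l2")
      case v: True
      show ?thesis
      proof
        fix i :: 'i
        \<comment> \<open>Coordinate i of \<open>S w\<close> is
          \<open>inner_l2 (adjoint S e) w\<close>; moving S to the fixed side lets the weak limit be
          taken.\<close>
        define e where "e = restr {i} (\<lambda>_. 1::complex)"
        have e: "e \<in> l2" by (simp add: e_def restr_l2)
        have ei: "w i = inner_l2 e w" for w by (simp add: e_def inner_restr)
        have S_i: "S w i = inner_l2 (adjoint S e) w" if w: "w \<in> l2" for w
          using arg_cong[OF adjoint_inner[OF Sb w e], of cnj] by (simp add: ei inner_cnj)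
        have "((\<lambda>n. inner_l2 (adjoint S e) (y n v)) \<longlongrightarrow> inner_l2 (adjoint S e) (T v)) H"
          by (rule weak_tendsto[OF coords evc[OF v] T(1)[OF v]]) (simp add: bopD(1) adjoint_bop Sb e)
        moreover have "\<forall>\<^sub>F n in H. inner_l2 (adjoint S e) (y n v) = y n (S v) i"
          using evM evc[OF v]
        proof eventually_elim
          case (elim n)
          then show ?case using fun_cong[OF fun_cong[OF comm, of "y n" v], of i] by (simp add: op_comp_def S_i)
        qed
        ultimately have "((\<lambda>n. y n (S v) i) \<longlongrightarrow> inner_l2 (adjoint S e) (T v)) H"
          by (rule Lim_transform_eventually)
        then have "T (S v) i = inner_l2 (adjoint S e) (T v)" by (rule tendsto_unique[OF H coords])
        then show "op_comp T S v i = op_comp S T v i" using S_i[OF T(1)[OF v]] by (simp add: op_comp_def)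
      qed
    next
      case False
      then show ?thesis using bop_zero_vec[OF bop] bop_zero_vec[OF Sb] by (simp add: op_comp_def T0 bopD(3)[OF Sb])
    qed
  qed
  then have "T \<in> commutant (commutant M)" using bop unfolding commutant_def by blast
  then have "T \<in> M" using vN by (simp add: von_neumann_algebra_def)
  with T show ?thesis by (simp add: opball_def)
qed

text \<open>Entries are contractions, so the coordinates at v lie in discs of radius
  \<open>norm_l2 v\<close> and Tychonoff applies. Positivity passes through the four weak limits in
  \<open>qform\<close>; the contraction bound, being only semicontinuous, takes a separate
  argument.\<close>

lemma X_set_cluster:
  assumes vN: "von_neumann_algebra N" and F: "F \<noteq> bot" and ev: "\<forall>\<^sub>F n in F. Y n \<in> X_set N"
  shows "\<exists>a\<in>X_set N. \<exists>H. H \<noteq> bot \<and> H \<le> F \<and> (\<forall>i j v k. ((\<lambda>n. Y n i j v k) \<longlongrightarrow> a i j v k) H)"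
proof -
  note Nb = von_neumann_bop[OF vN]
  define K :: "'a mat2 set" where "K = {a. \<forall>i. a i \<in> {b. \<forall>j. b j \<in> {T. \<forall>v. T v \<in> {w. \<forall>k. w k \<in> cball 0 (norm_l2 v)}}}}"
  have K: "compact K" unfolding K_def by (intro compact_all_coords compact_cball)
  have in_K: "y \<in> K" if "y \<in> X_set N" for y
  proof -
    have "cmod (y i j v k) \<le> norm_l2 v" for i j v k
    proof (cases "v \<in> l2")
      case True
      have "y i j \<in> opball N" by (rule X_set_entry[OF Nb that])
      then have "y i j v \<in> l2" "norm_l2 (y i j v) \<le> norm_l2 v" using True Nb by (auto simp: opball_def bopD)
      then show ?thesis using coord_le_norm[of "y i j v" k] by simp
    next
      case False
      have "y i j \<in> bop" using that Nb by (auto simp: X_set_def)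
      then show ?thesis using False by (simp add: bopD(3))
    qed
    then show ?thesis by (simp add: K_def)
  qed
  have "\<forall>\<^sub>F n in F. Y n \<in> K" using ev by (rule eventually_mono) (rule in_K)
  then obtain a H where "a \<in> K" and H: "H \<noteq> bot" "H \<le> F" "(Y \<longlongrightarrow> a) H"
    by (rule compact_cluster[OF K F])
  have coords: "((\<lambda>n. Y n i j v k) \<longlongrightarrow> a i j v k) H" for i j v k
    by (rule tendsto_coord[OF tendsto_coord[OF tendsto_coord[OF tendsto_coord[OF H(3)]]]])
  have evH: "\<forall>\<^sub>F n in H. Y n \<in> X_set N" using ev H(2) by (rule filter_leD[rotated])
  have evb: "\<forall>\<^sub>F n in H. Y n i j \<in> opball N" for i j
    using evH by (rule eventually_mono) (rule X_set_entry[OF Nb])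
  have ab: "a i j \<in> opball N" for i j
    by (rule opball_limit[OF vN H(1) evb coords])
  have evc: "\<forall>\<^sub>F n in H. Y n i j v \<in> l2 \<and> norm_l2 (Y n i j v) \<le> norm_l2 v" if "v \<in> l2" for v i j
    using evb[of i j] by (rule eventually_mono) (use that Nb in \<open>auto simp: opball_def bopD\<close>)
  have al: "a i j v \<in> l2" if "v \<in> l2" for v i j using ab[of i j] Nb that by (auto simp: opball_def bopD)
  have weak: "((\<lambda>n. inner_l2 u (Y n i j v)) \<longlongrightarrow> inner_l2 u (a i j v)) H" if "u \<in> l2" "v \<in> l2" for u v i j
    by (rule weak_tendsto[OF coords evc[OF that(2)] al[OF that(2)] that(1)])
  have "mat_pos N a" unfolding mat_pos_def
  proof (intro conjI allI ballI)
    show "a i j \<in> N" for i j using ab[of i j] by (simp add: opball_def)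
    fix u v :: "'a vec" assume uv: "u \<in> l2" "v \<in> l2"
    have lim: "((\<lambda>n. qform (Y n) u v) \<longlongrightarrow> qform a u v) H"
      unfolding qform_def by (intro tendsto_intros weak uv)
    have evq: "\<forall>\<^sub>F n in H. 0 \<le> Re (qform (Y n) u v) \<and> Im (qform (Y n) u v) = 0"
      using evH by (rule eventually_mono) (use uv in \<open>auto simp: X_set_iff[OF Nb] mat_pos_def\<close>)
    show "0 \<le> Re (qform a u v)"
      by (rule tendsto_lowerbound[OF tendsto_Re[OF lim] _ H(1)]) (use evq in \<open>auto elim: eventually_mono\<close>)
    have "((\<lambda>n. Im (qform (Y n) u v)) \<longlongrightarrow> 0) H"
      by (rule tendsto_eventually) (use evq in \<open>auto elim: eventually_mono\<close>)
    then show "Im (qform a u v) = 0" by (rule tendsto_unique[OF H(1) tendsto_Im[OF lim]])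
  qed
  moreover have "mat_contr a" unfolding mat_contr_def
  proof (intro ballI)
    fix u v :: "'a vec" assume uv: "u \<in> l2" "v \<in> l2"
    define w where "w n i = (\<lambda>k. Y n i False u k + Y n i True v k)" for n i
    define w0 where "w0 i = (\<lambda>k. a i False u k + a i True v k)" for i
    have w0: "w0 i \<in> l2" for i unfolding w0_def by (intro l2_add al uv)
    have evw: "\<forall>\<^sub>F n in H. w n i \<in> l2" for i
      using evc[OF uv(1), of i False] evc[OF uv(2), of i True]
      unfolding w_def by eventually_elim (auto intro: l2_add)
    let ?C = "(norm_l2 u)\<^sup>2 + (norm_l2 v)\<^sup>2"
    let ?A = "(norm_l2 (w0 False))\<^sup>2 + (norm_l2 (w0 True))\<^sup>2"
    have lim: "((\<lambda>n. inner_l2 (w0 i) (Y n i False u) + inner_l2 (w0 i) (Y n i True v))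
       \<longlongrightarrow> inner_l2 (w0 i) (a i False u) + inner_l2 (w0 i) (a i True v)) H" for i
      by (intro tendsto_intros weak uv w0)
    have "inner_l2 (w0 i) (a i False u) + inner_l2 (w0 i) (a i True v) = of_real ((norm_l2 (w0 i))\<^sup>2)" for i
      using inner_add_right[OF w0[of i] al[OF uv(1), of i False] al[OF uv(2), of i True]]
      unfolding w0_def[symmetric] inner_self[OF w0] by (rule sym)
    moreover have "\<forall>\<^sub>F n in H. inner_l2 (w0 i) (Y n i False u) + inner_l2 (w0 i) (Y n i True v) = inner_l2 (w0 i) (w n i)" for i
      using evc[OF uv(1), of i False] evc[OF uv(2), of i True]
      by eventually_elim (simp add: w_def inner_add_right w0)
    ultimately have lim': "((\<lambda>n. inner_l2 (w0 i) (w n i)) \<longlongrightarrow> of_real ((norm_l2 (w0 i))\<^sup>2)) H" for i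
      using Lim_transform_eventually[OF lim[of i]] by (simp only:)
    \<comment> \<open>Norms need not converge weakly. Instead, twice the real part of the inner
      product of \<open>w0 i\<close> and \<open>w n i\<close> is at most the sum of their squared
      norms; in the limit this reads 2 A <= A + C, hence A <= C.\<close>
    have "((\<lambda>n. 2 * Re (inner_l2 (w0 False) (w n False)) + 2 * Re (inner_l2 (w0 True) (w n True)))
        \<longlongrightarrow> 2 * Re (of_real ((norm_l2 (w0 False))\<^sup>2)) + 2 * Re (of_real ((norm_l2 (w0 True))\<^sup>2))) H"
      by (intro tendsto_intros lim')
    then have "2 * Re (of_real ((norm_l2 (w0 False))\<^sup>2)) + 2 * Re (of_real ((norm_l2 (w0 True))\<^sup>2)) \<le> ?A + ?C"
    proof (rule tendsto_upperbound[OF _ _ H(1)])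
      show "\<forall>\<^sub>F n in H. 2 * Re (inner_l2 (w0 False) (w n False)) + 2 * Re (inner_l2 (w0 True) (w n True)) \<le> ?A + ?C"
        using evw[of False] evw[of True] evH
      proof eventually_elim
        case (elim n)
        then have "mat_contr (Y n)" by (simp add: X_set_iff[OF Nb])
        then have "(norm_l2 (w n False))\<^sup>2 + (norm_l2 (w n True))\<^sup>2 \<le> ?C"
          using uv unfolding mat_contr_def w_def by simp
        then show ?case
          using Re_inner_bound[OF w0[of False] elim(1)] Re_inner_bound[OF w0[of True] elim(2)] by linarith
      qed
    qed
    then have "?A \<le> ?C" by simp
    then show "(norm_l2 (\<lambda>k. a False False u k + a False True v k))\<^sup>2
      + (norm_l2 (\<lambda>k. a True False u k + a True True v k))\<^sup>2 \<le> ?C"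
      unfolding w0_def .
  qed
  ultimately have "a \<in> X_set N" by (simp add: X_set_iff[OF Nb])
  with H coords show ?thesis by blast
qed

subsection \<open>Lip-von Neumann algebras\<close>

lemmas op_defs = op_zero_def op_add_def op_scale_def

lemma op_scale_scale: "op_scale a (op_scale b x) = op_scale (a * b) x"
  by (simp add: op_defs mult.assoc)

lemma op_scale_one: "op_scale 1 x = x"
  by (simp add: op_defs)

lemma op_scale_zero: "op_scale a op_zero = op_zero"
  by (simp add: op_defs)

lemma op_zero_scale: "op_scale 0 x = op_zero"
  by (simp add: op_defs)

lemma op_add_zero: "op_add x op_zero = x" "op_add op_zero x = x"
  by (simp_all add: op_defs)

lemma op_diff_self: "op_add x (op_scale (-1) x) = op_zero"
  by (simp add: op_defs)

lemma op_diff_eq_zero: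
  assumes "op_add x (op_scale (-1) y) = op_zero"
  shows "x = y"
proof (intro ext)
  fix v i
  show "x v i = y v i" using fun_cong[OF fun_cong[OF assms, of v], of i] by (simp add: op_defs)
qed

lemma op_diff_chain:
  "op_add (op_add x (op_scale (-1) y)) (op_add y (op_scale (-1) z)) = op_add x (op_scale (-1) z)"
  by (simp add: op_defs)

lemma op_scale_add: "op_scale a (op_add x y) = op_add (op_scale a x) (op_scale a y)"
  by (simp add: op_defs distrib_left)

lemma
  assumes "von_neumann_algebra M"
  shows vN_add: "x \<in> M \<Longrightarrow> y \<in> M \<Longrightarrow> op_add x y \<in> M"
    and vN_comp: "x \<in> M \<Longrightarrow> y \<in> M \<Longrightarrow> op_comp x y \<in> M"
    and vN_scale: "x \<in> M \<Longrightarrow> op_scale a x \<in> M"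
    and vN_adjoint: "x \<in> M \<Longrightarrow> adjoint x \<in> M"
    and vN_id: "op_id \<in> M"
    and vN_zero: "op_zero \<in> M"
    and vN_bop: "x \<in> M \<Longrightarrow> x \<in> bop"
proof -
  show 1: "x \<in> M \<Longrightarrow> op_scale a x \<in> M" "op_id \<in> M" for x a
    using assms by (auto simp: von_neumann_algebra_def)
  from this(1)[OF this(2), of 0] show "op_zero \<in> M" by (simp add: op_zero_scale)
qed (use assms in \<open>auto simp: von_neumann_algebra_def\<close>)

text \<open>A real \<open>Sup\<close> is informative only for bounded sets, hence the appeal to
  \<open>bop_bound\<close>; rescaling to unit vectors does the rest.\<close>

lemma op_norm_le_1:
  assumes T: "T \<in> bop"
  shows "op_norm T \<le> 1 \<longleftrightarrow> (\<forall>v\<in>l2. norm_l2 (T v) \<le> norm_l2 v)"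
proof
  let ?S = "{norm_l2 (T v) | v. v \<in> l2 \<and> norm_l2 v \<le> 1}"
  obtain C where C0: "C > 0" "\<forall>v\<in>l2. norm_l2 (T v) \<le> C * norm_l2 v" using bop_bound[OF T] by (elim exE conjE)
  have "bdd_above ?S"
  proof (rule bdd_aboveI[of _ C])
    fix r assume "r \<in> ?S"
    then obtain v where v: "r = norm_l2 (T v)" "v \<in> l2" "norm_l2 v \<le> 1" by auto
    have "r \<le> C * norm_l2 v" using C0 v by simp
    also have "\<dots> \<le> C" using C0(1) v(3) mult_left_mono[of "norm_l2 v" 1 C] by simp
    finally show "r \<le> C" .
  qed
  then have up: "norm_l2 (T v) \<le> op_norm T" if "v \<in> l2" "norm_l2 v \<le> 1" for v
    unfolding op_norm_def using that by (intro cSup_upper) auto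
  assume le: "op_norm T \<le> 1"
  show "\<forall>v\<in>l2. norm_l2 (T v) \<le> norm_l2 v"
  proof
    fix v :: "'a vec" assume v: "v \<in> l2"
    show "norm_l2 (T v) \<le> norm_l2 v"
    proof (cases "norm_l2 v = 0")
      case True
      then show ?thesis using norm_l2_eq_0[OF v] by (simp add: bop_zero_vec[OF T])
    next
      case False
      let ?a = "complex_of_real (1 / norm_l2 v)"
      have "norm_l2 (T (\<lambda>i. ?a * v i)) \<le> op_norm T"
        by (rule up[OF l2_scale[OF v]]) (use False in \<open>simp add: norm_l2_scale norm_divide del: of_real_divide\<close>)
      also have "norm_l2 (T (\<lambda>i. ?a * v i)) = norm_l2 (T v) / norm_l2 v"
        unfolding bop_scale[OF T v] norm_l2_scale norm_of_real by simp
      finally have "norm_l2 (T v) / norm_l2 v \<le> 1" using le by simp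
      then show ?thesis using False norm_l2_nonneg[of v] by (simp add: divide_le_eq_1)
    qed
  qed
next
  let ?S = "{norm_l2 (T v) | v. v \<in> l2 \<and> norm_l2 v \<le> 1}"
  assume c: "\<forall>v\<in>l2. norm_l2 (T v) \<le> norm_l2 v"
  have "norm_l2 (T (\<lambda>_. 0)) \<in> ?S" using l2_zero norm_l2_zero by fastforce
  then have "?S \<noteq> {}" by blast
  then show "op_norm T \<le> 1" unfolding op_norm_def
  proof (rule cSup_least)
    fix r assume "r \<in> ?S"
    then obtain v where "r = norm_l2 (T v)" "v \<in> l2" "norm_l2 v \<le> 1" by auto
    then show "r \<le> 1" using c by fastforce
  qed
qed

section \<open>The Lip-norm against the weak topology on the unit ball\<close>

lemma LvNA_D:
  assumes "LvNA M L"
  shows "von_neumann_algebra M" "norm_on M L"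
    "x \<in> M \<Longrightarrow> 0 \<le> L x" "x \<in> M \<Longrightarrow> L x = 0 \<longleftrightarrow> x = op_zero"
    "x \<in> M \<Longrightarrow> L (op_scale a x) = cmod a * L x"
    "x \<in> M \<Longrightarrow> y \<in> M \<Longrightarrow> L (op_add x y) \<le> L x + L y"
  using assms by (auto simp: LvNA_def norm_on_def)

text \<open>The open L-ball about T, cut down to the unit ball, is L-open by the triangle
  inequality, and the topological condition in \<open>LvNA\<close> at radius 1 makes it weakly
  open.\<close>

lemma LvNA_nhd:
  assumes M: "LvNA M L" and T: "T \<in> opball M" and e: "0 < e"
  shows "\<exists>F d. finite F \<and> F \<subseteq> l2 \<times> l2 \<and> (0::real) < d \<and>
    (\<forall>y\<in>opball M. (\<forall>(u,v)\<in>F. cmod (inner_l2 u (y v) - inner_l2 u (T v)) < d)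
       \<longrightarrow> L (op_add y (op_scale (-1) T)) < e)"
proof -
  note vN = LvNA_D(1)[OF M] note Mcl = vN_add[OF vN] vN_scale[OF vN]
  define B where "B = {x \<in> M. op_norm x \<le> 1}"
  have B: "B = opball M" unfolding B_def opball_def
    by (rule Collect_cong) (use vN_bop[OF vN] op_norm_le_1 in blast)
  define U where "U = {y \<in> B. L (op_add y (op_scale (-1) T)) < e}"
  have TM: "T \<in> M" using T by (simp add: opball_def)
  have "L_open_in L B U" unfolding L_open_in_def
  proof (intro conjI ballI)
    show "U \<subseteq> B" by (auto simp: U_def)
    fix x assume x: "x \<in> U"
    then have xM: "x \<in> M" by (simp add: U_def B_def)
    show "\<exists>\<epsilon>>0. \<forall>y\<in>B. L (op_add y (op_scale (- 1) x)) < \<epsilon> \<longrightarrow> y \<in> U"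
    proof (intro exI[of _ "e - L (op_add x (op_scale (-1) T))"] conjI ballI impI)
      show "0 < e - L (op_add x (op_scale (-1) T))" using x by (simp add: U_def)
      fix y assume y: "y \<in> B" "L (op_add y (op_scale (- 1) x)) < e - L (op_add x (op_scale (-1) T))"
      have yM: "y \<in> M" using y by (simp add: B_def)
      have "L (op_add y (op_scale (-1) T)) \<le> L (op_add y (op_scale (- 1) x)) + L (op_add x (op_scale (-1) T))"
        unfolding op_diff_chain[of y x T, symmetric] by (intro LvNA_D(6)[OF M] Mcl xM yM TM)
      then show "y \<in> U" using y by (simp add: U_def)
    qed
  qed
  then have "wot_open_in B U" using M unfolding LvNA_def B_def by blast
  moreover have "T \<in> U" using T e LvNA_D(4)[OF M vN_zero[OF vN]] by (simp add: U_def B op_diff_self)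
  ultimately obtain F d where "finite F" "F \<subseteq> l2 \<times> l2" "d > 0"
    "\<forall>y\<in>B. (\<forall>(u,v)\<in>F. cmod (inner_l2 u (y v) - inner_l2 u (T v)) < d) \<longrightarrow> y \<in> U"
    unfolding wot_open_in_def by meson
  then show ?thesis by (intro exI[of _ F] exI[of _ d]) (auto simp: B U_def)
qed

text \<open>A weak neighbourhood of zero on which L is below 1 absorbs the unit ball after scaling
  by a fixed t, so homogeneity gives the bound 1 / t. This keeps the suprema in \<open>distH\<close>
  finite.\<close>

lemma LvNA_bounded:
  assumes M: "LvNA M L"
  shows "\<exists>K. \<forall>x\<in>opball M. L x \<le> K"
proof -
  note vN = LvNA_D(1)[OF M]
  have z: "op_zero \<in> opball M" using vN_zero[OF vN] by (simp add: opball_def op_defs)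
  obtain F d where F: "finite F" "F \<subseteq> l2 \<times> l2" "(0::real) < d"
    and nhd: "\<forall>y\<in>opball M. (\<forall>(u,v)\<in>F. cmod (inner_l2 u (y v) - inner_l2 u (op_zero v)) < d)
       \<longrightarrow> L (op_add y (op_scale (-1) op_zero)) < 1"
    using LvNA_nhd[OF M z zero_less_one] by (elim exE conjE)
  define S where "S = (\<Sum>(u,v)\<in>F. norm_l2 u * norm_l2 v)"
  have S: "norm_l2 u * norm_l2 v \<le> S" if "(u,v) \<in> F" for u v
    unfolding S_def using member_le_sum[OF that, of "\<lambda>(u,v). norm_l2 u * norm_l2 v"] F(1) by auto
  have S0: "0 \<le> S" unfolding S_def by (intro sum_nonneg) auto
  \<comment> \<open>Chosen so that t <= 1 keeps the scaled operator in the unit ball while t * S < d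
    puts it into the neighbourhood, also when S = 0.\<close>
  define t where "t = d / (S + d)"
  have t: "0 < t" "t \<le> 1" "t * S < d" using S0 F(3) by (auto simp: t_def field_simps)
  have "L x \<le> 1 / t" if x: "x \<in> opball M" for x
  proof -
    have xM: "x \<in> M" and xb: "x \<in> bop" and xc: "\<And>v. v \<in> l2 \<Longrightarrow> norm_l2 (x v) \<le> norm_l2 v"
      using x vN_bop[OF vN] by (auto simp: opball_def)
    let ?y = "op_scale (of_real t) x"
    have "norm_l2 (?y v) \<le> norm_l2 v" if "v \<in> l2" for v
      using xc[OF that] mult_right_mono[of t 1 "norm_l2 (x v)"] t by (simp add: op_scale_def norm_l2_scale)
    then have y: "?y \<in> opball M" using vN_scale[OF vN xM] by (simp add: opball_def)
    have "cmod (inner_l2 u (?y v) - inner_l2 u (op_zero v)) < d" if uv: "(u,v) \<in> F" for u v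
    proof -
      have l: "u \<in> l2" "v \<in> l2" using uv F(2) by auto
      have "cmod (inner_l2 u (x v)) \<le> norm_l2 u * norm_l2 (x v)" by (intro cauchy_schwarz l bopD(1)[OF xb])
      also have "\<dots> \<le> norm_l2 u * norm_l2 v" by (intro mult_left_mono xc l norm_l2_nonneg)
      also have "\<dots> \<le> S" by (rule S[OF uv])
      finally have "t * cmod (inner_l2 u (x v)) \<le> t * S" using t(1) by (intro mult_left_mono) auto
      then have "t * cmod (inner_l2 u (x v)) < d" using t(3) by linarith
      then show ?thesis using t(1) by (simp add: op_defs inner_scale_right norm_mult)
    qed
    then have "L (op_add ?y (op_scale (-1) op_zero)) < 1" using nhd y by auto
    then have "t * L x < 1" using t LvNA_D(5)[OF M xM] by (simp add: op_scale_zero op_add_zero)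
    then show ?thesis using t by (simp add: field_simps)
  qed
  then show ?thesis by blast
qed

text \<open>A weak neighbourhood tests only finitely many pairs of vectors, and on each of them
  coordinatewise convergence suffices. This carries the limits produced by Tychonoff over to the
  Lip-norm.\<close>

lemma LvNA_tendsto:
  assumes M: "LvNA M L" and T: "T \<in> opball M" and ev: "\<forall>\<^sub>F n in H. y n \<in> opball M"
    and coords: "\<And>v i. ((\<lambda>n. y n v i) \<longlongrightarrow> T v i) H"
  shows "((\<lambda>n. L (op_add (y n) (op_scale (-1) T))) \<longlongrightarrow> 0) H"
proof (rule tendstoI)
  fix e :: real assume e: "e > 0"
  note vN = LvNA_D(1)[OF M]
  obtain F d where F: "finite F" "F \<subseteq> l2 \<times> l2" "(0::real) < d"
    and nhd: "\<forall>y\<in>opball M. (\<forall>(u,v)\<in>F. cmod (inner_l2 u (y v) - inner_l2 u (T v)) < d)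
       \<longrightarrow> L (op_add y (op_scale (-1) T)) < e"
    using LvNA_nhd[OF M T e] by (elim exE conjE)
  have "\<forall>\<^sub>F n in H. case p of (u, v) \<Rightarrow> cmod (inner_l2 u (y n v) - inner_l2 u (T v)) < d" if p: "p \<in> F" for p
  proof -
    obtain u v where uv: "p = (u, v)" "u \<in> l2" "v \<in> l2" using p F(2) by auto
    have "((\<lambda>n. inner_l2 u (y n v)) \<longlongrightarrow> inner_l2 u (T v)) H"
    proof (rule weak_tendsto[OF coords _ _ uv(2)])
      show "\<forall>\<^sub>F n in H. y n v \<in> l2 \<and> norm_l2 (y n v) \<le> norm_l2 v"
        using ev by (rule eventually_mono) (use uv in \<open>auto simp: opball_def bopD(1)[OF vN_bop[OF vN]]\<close>)
      show "T v \<in> l2" using T uv by (auto simp: opball_def bopD(1)[OF vN_bop[OF vN]])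
    qed
    from tendstoD[OF this F(3)] show ?thesis by (simp add: uv(1) dist_norm)
  qed
  then have "\<forall>\<^sub>F n in H. \<forall>p\<in>F. case p of (u, v) \<Rightarrow> cmod (inner_l2 u (y n v) - inner_l2 u (T v)) < d"
    by (intro eventually_ball_finite F(1) ballI)
  with ev show "\<forall>\<^sub>F n in H. dist (L (op_add (y n) (op_scale (-1) T))) 0 < e"
  proof eventually_elim
    case (elim n)
    have "op_add (y n) (op_scale (-1) T) \<in> M"
      using elim(1) T by (auto simp: opball_def intro: vN_add[OF vN] vN_scale[OF vN])
    then show ?case using nhd elim LvNA_D(3)[OF M] by simp
  qed
qed

subsection \<open>The infimum in the distance is attained\<close>

lemma LsetD:
  assumes "L \<in> Lset M LM N LN"
  shows "x \<in> M \<Longrightarrow> y \<in> N \<Longrightarrow> 0 \<le> L (x, y)"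
    "x \<in> M \<Longrightarrow> y \<in> N \<Longrightarrow> L (op_scale a x, op_scale a y) = cmod a * L (x, y)"
    "x \<in> M \<Longrightarrow> y \<in> N \<Longrightarrow> x' \<in> M \<Longrightarrow> y' \<in> N \<Longrightarrow> L (op_add x x', op_add y y') \<le> L (x, y) + L (x', y')"
    "x \<in> M \<Longrightarrow> L (x, op_zero) = LM x"
    "y \<in> N \<Longrightarrow> L (op_zero, y) = LN y"
  using assms by (simp_all add: Lset_def)

lemma Lset_swap:
  assumes "L \<in> Lset M LM N LN"
  shows "(\<lambda>p. L (snd p, fst p)) \<in> Lset N LN M LM"
  using assms by (simp add: Lset_def)

text \<open>Homogeneity with factor -1 moves the sign across, so both halves of the Hausdorff
  distance fall under one lemma with M and N exchanged.\<close>

lemma Lset_flip: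
  assumes L: "L \<in> Lset M LM N LN" and vN: "von_neumann_algebra N" and x: "x \<in> M" and y: "y \<in> N"
  shows "L (op_scale (-1) x, y) = L (x, op_scale (-1) y)"
  using LsetD(2)[OF L x vN_scale[OF vN y], of "-1" "-1"] by (simp add: op_scale_scale op_scale_one)

lemma Lmat_less: "Lmat L a b < e \<longleftrightarrow> (\<forall>i j. L (a i j, b i j) < e)"
proof -
  have "{L (a i j, b i j) | i j. True} = (\<lambda>(i, j). L (a i j, b i j)) ` UNIV" by auto
  then show ?thesis unfolding Lmat_def by (subst Max_less_iff) auto
qed

lemma Lmat_ge: "L (a i j, b i j) \<le> Lmat L a b"
  by (rule leI) (simp add: Lmat_less, blast)

lemma Lmat_le: "(\<And>i j. L (a i j, b i j) \<le> K) \<Longrightarrow> Lmat L a b \<le> K"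
  by (rule dense_ge, rule less_imp_le, simp add: Lmat_less) (blast intro: le_less_trans)

lemma zero_X_set: "von_neumann_algebra M \<Longrightarrow> (\<lambda>i j. op_zero) \<in> X_set M"
  by (simp add: X_set_iff von_neumann_bop mat_pos_def mat_contr_def qform_def vN_zero)
    (simp add: op_zero_def)

text \<open>Real suprema and infima need bounded sets: nonnegativity bounds each inner set from
  below, and the single point b bounds all the infima from above.\<close>

lemma Sup_Inf_less:
  fixes D :: "'a \<Rightarrow> 'b \<Rightarrow> real"
  assumes less: "Sup ((\<lambda>x. Inf (D x ` B)) ` A) < e"
    and bd: "\<And>x. x \<in> A \<Longrightarrow> D x b \<le> K" and b: "b \<in> B"
    and nonneg: "\<And>x y. x \<in> A \<Longrightarrow> y \<in> B \<Longrightarrow> 0 \<le> D x y" and x: "x \<in> A"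
  shows "\<exists>y\<in>B. D x y < e"
proof -
  have "Inf (D x ` B) \<le> K" if "x \<in> A" for x
    by (rule order_trans[OF cInf_lower bd[OF that]]) (use that b nonneg in \<open>auto intro!: bdd_belowI2[of _ 0]\<close>)
  then have "Inf (D x ` B) \<le> Sup ((\<lambda>x. Inf (D x ` B)) ` A)"
    using x by (intro cSup_upper) (auto intro!: bdd_aboveI2[of _ _ K])
  then have "Inf (D x ` B) < e" using less by simp
  then show ?thesis using b cInf_lessD[of "D x ` B" e] by blast
qed

text \<open>The zero matrix is the comparison point for \<open>Sup_Inf_less\<close>: against it a
  seminorm in \<open>Lset\<close> reduces to \<open>LM\<close> or \<open>LN\<close>, which are
  bounded on unit balls.\<close>

lemma distH_less:
  assumes M: "LvNA M LM" and N: "LvNA N LN" and L: "L \<in> Lset M LM N LN" and less: "distH M N L < e"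
  shows "x \<in> X_set M \<Longrightarrow> \<exists>y\<in>X_set N. \<forall>i j. L (x i j, op_scale (-1) (y i j)) < e"
    and "y \<in> X_set N \<Longrightarrow> \<exists>x\<in>X_set M. \<forall>i j. L (x i j, op_scale (-1) (y i j)) < e"
proof -
  note vM = LvNA_D(1)[OF M] and vN = LvNA_D(1)[OF N]
  obtain KM where KM: "\<And>x. x \<in> opball M \<Longrightarrow> LM x \<le> KM" using LvNA_bounded[OF M] by blast
  obtain KN where KN: "\<And>x. x \<in> opball N \<Longrightarrow> LN x \<le> KN" using LvNA_bounded[OF N] by blast
  have nonneg: "0 \<le> Lmat L x (mat_neg y)" if "x \<in> X_set M" "y \<in> X_set N" for x y
  proof -
    have "x False False \<in> M" using that by (simp add: X_set_def)
    moreover have "mat_neg y False False \<in> N" using that vN_scale[OF vN] by (simp add: X_set_def mat_neg_def)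
    ultimately have "0 \<le> L (x False False, mat_neg y False False)" by (rule LsetD(1)[OF L])
    also have "\<dots> \<le> Lmat L x (mat_neg y)" by (rule Lmat_ge)
    finally show ?thesis .
  qed
  show "\<exists>y\<in>X_set N. \<forall>i j. L (x i j, op_scale (-1) (y i j)) < e" if x: "x \<in> X_set M"
  proof -
    have "\<exists>y\<in>X_set N. Lmat L x (mat_neg y) < e"
    proof (rule Sup_Inf_less[where b = "\<lambda>i j. op_zero" and K = KM and A = "X_set M" and x = x
        and D = "\<lambda>x y. Lmat L x (mat_neg y)"])
      show "Lmat L x (mat_neg (\<lambda>i j. op_zero)) \<le> KM" if x: "x \<in> X_set M" for x
      proof (rule Lmat_le)
        fix i j
        have "x i j \<in> opball M" using von_neumann_bop[OF vM] x by (rule X_set_entry)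
        then show "L (x i j, mat_neg (\<lambda>i j. op_zero) i j) \<le> KM"
          using KM LsetD(4)[OF L] by (simp add: mat_neg_def op_scale_zero opball_def)
      qed
    qed (use less x nonneg zero_X_set[OF vN] in \<open>auto simp: distH_def\<close>)
    then show ?thesis by (simp add: Lmat_less mat_neg_def)
  qed
  show "\<exists>x\<in>X_set M. \<forall>i j. L (x i j, op_scale (-1) (y i j)) < e" if y: "y \<in> X_set N"
  proof -
    have "\<exists>x\<in>X_set M. Lmat L x (mat_neg y) < e"
    proof (rule Sup_Inf_less[where b = "\<lambda>i j. op_zero" and K = KN and A = "X_set N" and x = y
        and D = "\<lambda>y x. Lmat L x (mat_neg y)"])
      show "Lmat L (\<lambda>i j. op_zero) (mat_neg y) \<le> KN" if y: "y \<in> X_set N" for y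
      proof (rule Lmat_le)
        fix i j
        have y: "y i j \<in> opball N" using von_neumann_bop[OF vN] y by (rule X_set_entry)
        then have "y i j \<in> N" by (simp add: opball_def)
        then show "L (op_zero, mat_neg y i j) \<le> KN"
          using KN[OF y] LsetD(5)[OF L vN_scale[OF vN]] LvNA_D(5)[OF N] by (simp add: mat_neg_def)
      qed
    qed (use less y nonneg zero_X_set[OF vM] in \<open>auto simp: distH_def\<close>)
    then show ?thesis by (simp add: Lmat_less mat_neg_def)
  qed
qed

text \<open>The partners \<open>Y n\<close> belong to varying seminorms, yet exchanging
  \<open>Y n\<close> for its cluster point a costs \<open>LN\<close> of the difference whichever
  seminorm is evaluated, and this cost tends to zero.\<close>

lemma near_pairs_limit:
  assumes M: "LvNA M LM" and N: "LvNA N LN"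
    and Ls: "\<And>n. Ls n \<in> Lset M LM N LN" and L: "L \<in> Lset M LM N LN"
    and H: "H \<noteq> bot" "H \<le> sequentially"
    and lim: "\<And>x y. x \<in> M \<Longrightarrow> y \<in> N \<Longrightarrow> ((\<lambda>n. Ls n (x, y)) \<longlongrightarrow> L (x, y)) H"
    and near: "\<And>n. \<exists>y\<in>X_set N. \<forall>i j. Ls n (x i j, op_scale (-1) (y i j)) < 1 / real (Suc n)"
    and x: "x \<in> X_set M"
  shows "\<exists>y\<in>X_set N. \<forall>i j. L (x i j, op_scale (-1) (y i j)) = 0"
proof -
  note vM = LvNA_D(1)[OF M] and vN = LvNA_D(1)[OF N]
  have "\<forall>n. \<exists>y. y \<in> X_set N \<and> (\<forall>i j. Ls n (x i j, op_scale (-1) (y i j)) < 1 / real (Suc n))"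
    using near by (simp only: Bex_def simp_thms)
  then obtain Y where Y0: "\<forall>n. Y n \<in> X_set N \<and> (\<forall>i j. Ls n (x i j, op_scale (-1) (Y n i j)) < 1 / real (Suc n))"
    by (rule exE[OF choice])
  have Y: "Y n \<in> X_set N" "Ls n (x i j, op_scale (-1) (Y n i j)) < 1 / real (Suc n)" for n i j
    using Y0 by simp_all
  \<comment> \<open>Refining H keeps the convergence of the seminorms and adds that of the
    partners.\<close>
  obtain a H' where a: "a \<in> X_set N" and H': "H' \<noteq> bot" "H' \<le> H"
    and coords0: "\<forall>i j v k. ((\<lambda>n. Y n i j v k) \<longlongrightarrow> a i j v k) H'"
    using X_set_cluster[OF vN H(1), of Y, OF always_eventually[OF allI[OF Y(1)]]] by (elim bexE exE conjE)
  note coords = coords0[rule_format]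
  have "L (x i j, op_scale (-1) (a i j)) = 0" for i j
  proof -
    have xM: "x i j \<in> M" using x by (simp add: X_set_def)
    have aN: "a i j \<in> N" using a by (simp add: X_set_def)
    have YN: "Y n i j \<in> N" for n using Y(1) by (simp add: X_set_def)
    have maN: "op_scale (-1) (a i j) \<in> N" by (rule vN_scale[OF vN aN])
    have "((\<lambda>n. LN (op_add (Y n i j) (op_scale (-1) (a i j)))) \<longlongrightarrow> 0) H'"
      by (rule LvNA_tendsto[OF N X_set_entry[OF von_neumann_bop[OF vN] a]
            always_eventually[OF allI[OF X_set_entry[OF von_neumann_bop[OF vN] Y(1)]]] coords])
    moreover have "((\<lambda>n. 1 / real (Suc n)) \<longlongrightarrow> 0) H'"
      by (rule tendsto_mono[OF order_trans[OF H'(2) H(2)]])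
        (use LIMSEQ_inverse_real_of_nat in \<open>simp add: inverse_eq_divide\<close>)
    ultimately have lim1: "((\<lambda>n. 1 / real (Suc n) + LN (op_add (Y n i j) (op_scale (-1) (a i j)))) \<longlongrightarrow> 0 + 0) H'"
      by (rule tendsto_add[rotated])
    have lim2: "((\<lambda>n. Ls n (x i j, op_scale (-1) (a i j))) \<longlongrightarrow> L (x i j, op_scale (-1) (a i j))) H'"
      by (rule tendsto_mono[OF H'(2) lim[OF xM maN]])
    have le: "Ls n (x i j, op_scale (-1) (a i j))
        \<le> 1 / real (Suc n) + LN (op_add (Y n i j) (op_scale (-1) (a i j)))" for n
    proof -
      have d: "op_add (Y n i j) (op_scale (-1) (a i j)) \<in> N" by (rule vN_add[OF vN YN maN])
      have "op_add (op_scale (-1) (Y n i j)) (op_add (Y n i j) (op_scale (-1) (a i j))) = op_scale (-1) (a i j)"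
        by (simp add: op_defs)
      then have "Ls n (x i j, op_scale (-1) (a i j))
         \<le> Ls n (x i j, op_scale (-1) (Y n i j)) + Ls n (op_zero, op_add (Y n i j) (op_scale (-1) (a i j)))"
        using LsetD(3)[OF Ls xM vN_scale[OF vN YN] vN_zero[OF vM] d, of n "-1" n] by (simp add: op_add_zero)
      then show ?thesis using Y(2)[of n i j] LsetD(5)[OF Ls d, of n] by simp
    qed
    have "L (x i j, op_scale (-1) (a i j)) \<le> 0 + 0"
      by (rule tendsto_le[OF H'(1) lim1 lim2 always_eventually[OF allI[OF le]]])
    then show ?thesis using LsetD(1)[OF L xM maN] by simp
  qed
  with a show ?thesis by blast
qed

lemma dist_zero_attained:
  assumes M: "LvNA M LM" and N: "LvNA N LN" and dist: "dist_qGH M LM N LN = 0"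
  obtains L where "L \<in> Lset M LM N LN"
    "\<forall>x\<in>X_set M. \<exists>y\<in>X_set N. \<forall>i j. L (x i j, op_scale (-1) (y i j)) = 0"
    "\<forall>y\<in>X_set N. \<exists>x\<in>X_set M. \<forall>i j. L (x i j, op_scale (-1) (y i j)) = 0"
proof -
  note vM = LvNA_D(1)[OF M] and vN = LvNA_D(1)[OF N]
  \<comment> \<open>The sum seminorm shows that the infimum defining the distance runs over a
    nonempty set, so near-minimisers exist.\<close>
  have "(\<lambda>(x, y). LM x + LN y) \<in> Lset M LM N LN"
    unfolding Lset_def mem_Collect_eq prod.case
  proof (intro conjI ballI allI)
    fix x y x' y' assume "x \<in> M" "y \<in> N" "x' \<in> M" "y' \<in> N"
    then show "LM (op_add x x') + LN (op_add y y') \<le> LM x + LN y + (LM x' + LN y')"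
      using LvNA_D(6)[OF M, of x x'] LvNA_D(6)[OF N, of y y'] by linarith
  qed (simp_all add: LvNA_D(3,5)[OF M] LvNA_D(3,5)[OF N] LvNA_D(4)[OF M vN_zero[OF vM]]
      LvNA_D(4)[OF N vN_zero[OF vN]] distrib_left)
  then have ne: "distH M N ` Lset M LM N LN \<noteq> {}" by blast
  have "\<exists>L. L \<in> Lset M LM N LN \<and> distH M N L < 1 / real (Suc n)" for n
  proof -
    have "Inf (distH M N ` Lset M LM N LN) < 1 / real (Suc n)"
      using dist unfolding dist_qGH_def by simp
    from cInf_lessD[OF ne this] show ?thesis by blast
  qed
  then obtain Ls where Ls: "\<And>n. Ls n \<in> Lset M LM N LN" "\<And>n. distH M N (Ls n) < 1 / real (Suc n)"
    using choice[of "\<lambda>n L. L \<in> Lset M LM N LN \<and> distH M N L < 1 / real (Suc n)"] by auto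
  have le: "Ls n (x, y) \<le> LM x + LN y" if "x \<in> M" "y \<in> N" for n x y
    using LsetD(3)[OF Ls(1) that(1) vN_zero[OF vN] vN_zero[OF vM] that(2), of n]
    by (simp add: op_add_zero LsetD(4)[OF Ls(1)] LsetD(5)[OF Ls(1)] that)
  define K where "K = {f. \<forall>p. f p \<in> (if p \<in> M \<times> N then {0..LM (fst p) + LN (snd p)} else {0})}"
  have "compact K" unfolding K_def by (intro compact_all_coords) simp
  \<comment> \<open>Members of \<open>Lset\<close> are unconstrained off
    \<open>M \<times> N\<close>; setting them to zero there places the sequence in a compact
    product.\<close>
  define Lr where "Lr n p = (if p \<in> M \<times> N then Ls n p else 0)" for n p
  have "Lr n \<in> K" for n using le LsetD(1)[OF Ls(1)] by (auto simp: K_def Lr_def)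
  then have "\<forall>\<^sub>F n in sequentially. Lr n \<in> K" by simp
  then obtain L H where H: "H \<noteq> bot" "H \<le> sequentially" and LrL: "(Lr \<longlongrightarrow> L) H"
    by (rule compact_cluster[OF \<open>compact K\<close> sequentially_bot])
  have lim: "((\<lambda>n. Ls n (x, y)) \<longlongrightarrow> L (x, y)) H" if "x \<in> M" "y \<in> N" for x y
    using tendsto_coord[OF LrL, of "(x, y)"] that by (simp add: Lr_def)
  have L: "L \<in> Lset M LM N LN" unfolding Lset_def mem_Collect_eq
  proof (intro conjI ballI allI)
    fix x y a assume xy: "x \<in> M" "y \<in> N"
    show "0 \<le> L (x, y)"
      by (rule tendsto_lowerbound[OF lim[OF xy] _ H(1)]) (simp add: LsetD(1)[OF Ls(1)] xy)
    have "((\<lambda>n. cmod a * Ls n (x, y)) \<longlongrightarrow> cmod a * L (x, y)) H" by (intro tendsto_intros lim xy)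
    then have "((\<lambda>n. Ls n (op_scale a x, op_scale a y)) \<longlongrightarrow> cmod a * L (x, y)) H"
      by (simp add: LsetD(2)[OF Ls(1)] xy)
    then show "L (op_scale a x, op_scale a y) = cmod a * L (x, y)"
      by (rule tendsto_unique[OF H(1) lim[OF vN_scale[OF vM xy(1)] vN_scale[OF vN xy(2)]]])
  next
    fix x y x' y' assume *: "x \<in> M" "y \<in> N" "x' \<in> M" "y' \<in> N"
    show "L (op_add x x', op_add y y') \<le> L (x, y) + L (x', y')"
    proof (rule tendsto_le[OF H(1)])
      show "((\<lambda>n. Ls n (x, y) + Ls n (x', y')) \<longlongrightarrow> L (x, y) + L (x', y')) H"
        by (intro tendsto_add lim *)
      show "((\<lambda>n. Ls n (op_add x x', op_add y y')) \<longlongrightarrow> L (op_add x x', op_add y y')) H"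
        by (intro lim vN_add[OF vM] vN_add[OF vN] *)
    qed (simp add: LsetD(3)[OF Ls(1)] *)
  next
    fix x assume x: "x \<in> M"
    show "L (x, op_zero) = LM x"
      using tendsto_unique[OF H(1) lim[OF x vN_zero[OF vN]], of "LM x"] by (simp add: LsetD(4)[OF Ls(1)] x)
  next
    fix y assume y: "y \<in> N"
    show "L (op_zero, y) = LN y"
      using tendsto_unique[OF H(1) lim[OF vN_zero[OF vM] y], of "LN y"] by (simp add: LsetD(5)[OF Ls(1)] y)
  qed
  show thesis
  proof (rule that[OF L]; rule ballI)
    fix x assume x: "x \<in> X_set M"
    show "\<exists>y\<in>X_set N. \<forall>i j. L (x i j, op_scale (-1) (y i j)) = 0"
      by (rule near_pairs_limit[OF M N Ls(1) L H lim distH_less(1)[OF M N Ls x] x])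
  next
    fix y assume y: "y \<in> X_set N"
    have flip: "L' (op_scale (-1) (x i j), y i j) = L' (x i j, op_scale (-1) (y i j))"
      if "L' \<in> Lset M LM N LN" "x \<in> X_set M" for L' x i j
      using that y by (intro Lset_flip[OF that(1) vN]) (auto simp: X_set_def)
    have "\<exists>x\<in>X_set M. \<forall>i j. (\<lambda>p. L (snd p, fst p)) (y i j, op_scale (-1) (x i j)) = 0"
    proof (rule near_pairs_limit[OF N M Lset_swap[OF Ls(1)] Lset_swap[OF L] H _ _ y])
      show "((\<lambda>n. Ls n (snd (u, v), fst (u, v))) \<longlongrightarrow> L (snd (u, v), fst (u, v))) H" if "u \<in> N" "v \<in> M" for u v
        using lim[OF that(2,1)] by simp
      show "\<exists>x\<in>X_set M. \<forall>i j. Ls n (snd (y i j, op_scale (-1) (x i j)), fst (y i j, op_scale (-1) (x i j))) < 1 / real (Suc n)" for n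
        using distH_less(2)[OF M N Ls y, of n] by (simp add: flip[OF Ls(1)])
    qed
    then show "\<exists>x\<in>X_set M. \<forall>i j. L (x i j, op_scale (-1) (y i j)) = 0" by (simp add: flip[OF L])
  qed
qed

subsection \<open>Unital order isomorphisms of matrices of order two\<close>

text \<open>Here z and w are the values of a sesquilinear defect at (u, v) and (v, u). Testing the
  diagonal at u + v gives the first equation, at u plus i times v the second.\<close>

lemma polarization:
  fixes z w :: complex
  assumes "z + w = 0" "\<i> * z - \<i> * w = 0"
  shows "z = 0"
proof -
  have "z = w" using assms(2) by simp
  with assms(1) show ?thesis by simp
qed

text \<open>Lets two opposite inequalities between quadratic forms yield equality of operators,
  which is how unitality and preservation of squares are obtained.\<close>

lemma bop_quad_ext:
  assumes S: "S \<in> bop" and T: "T \<in> bop"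
    and eq: "\<And>v. v \<in> l2 \<Longrightarrow> inner_l2 v (S v) = inner_l2 v (T v)"
  shows "S = T"
proof (rule bop_ext[OF S T])
  fix u v :: "'a vec" assume u: "u \<in> l2" and v: "v \<in> l2"
  note [simp] = inner_add_left inner_add_right inner_scale_left inner_scale_right bop_add bop_scale
    S T u v bopD(1) l2_add l2_scale
  have iv: "(\<lambda>i. \<i> * v i) \<in> l2" by (rule l2_scale[OF v])
  have "inner_l2 u (S v) + inner_l2 v (S u) = inner_l2 u (T v) + inner_l2 v (T u)"
    using eq[OF l2_add[OF u v]] eq[OF u] eq[OF v] by (simp add: algebra_simps)
  moreover have "\<i> * inner_l2 u (S v) - \<i> * inner_l2 v (S u) = \<i> * inner_l2 u (T v) - \<i> * inner_l2 v (T u)"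
    using eq[OF l2_add[OF u iv]] eq[OF u] eq[OF v]
    by (simp add: bop_add[OF S u iv] bop_add[OF T u iv] bop_scale[OF S v] bop_scale[OF T v] algebra_simps)
  ultimately show "inner_l2 u (S v) = inner_l2 u (T v)"
    using polarization[of "inner_l2 u (S v) - inner_l2 u (T v)" "inner_l2 v (S u) - inner_l2 v (T u)"]
    by (simp add: algebra_simps)
qed

definition mat2 :: "'i op \<Rightarrow> 'i op \<Rightarrow> 'i op \<Rightarrow> 'i op \<Rightarrow> 'i mat2" where
  "mat2 a b c d = (\<lambda>i j. if i then (if j then d else c) else (if j then b else a))"

lemma mat2_simps [simp]:
  "mat2 a b c d False False = a" "mat2 a b c d False True = b"
  "mat2 a b c d True False = c" "mat2 a b c d True True = d"
  by (simp_all add: mat2_def)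

lemma mat2_map: "(\<lambda>i j. f (mat2 a b c d i j)) = mat2 (f a) (f b) (f c) (f d)"
  by (simp add: mat2_def fun_eq_iff)

lemma mat_pos_in: "mat_pos M a \<Longrightarrow> a i j \<in> M"
  by (simp add: mat_pos_def)

text \<open>The maps of interest are known to respect the order of matrices, so positivity of a
  single operator is transported by padding it with zeros.\<close>

lemma mat_pos_diag:
  "mat_pos M (mat2 a op_zero op_zero op_zero) \<longleftrightarrow> a \<in> M \<and> op_zero \<in> M
     \<and> (\<forall>v\<in>l2. 0 \<le> Re (inner_l2 v (a v)) \<and> Im (inner_l2 v (a v)) = 0)"
proof -
  have "qform (mat2 a op_zero op_zero op_zero) u v = inner_l2 u (a u)" for u v
    by (simp add: qform_def op_zero_def)
  moreover have "(\<forall>i j. mat2 a op_zero op_zero op_zero i j \<in> M) \<longleftrightarrow> a \<in> M \<and> op_zero \<in> M"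
    by (auto simp: mat2_def)
  moreover have "l2 \<noteq> {}" using l2_zero by blast
  ultimately show ?thesis by (auto simp: mat_pos_def)
qed

text \<open>A real-valued form comes from a hermitian matrix: the values at (u, 0) and (0, v) remove
  the diagonal terms, those at (u, v) and (u, i v) match imaginary and real parts off the diagonal.
  Preservation of adjoints stems from here.\<close>

lemma mat_pos_adjoint:
  assumes M: "M \<subseteq> bop" and a: "mat_pos M a"
  shows "adjoint (a False True) = a True False"
proof (rule adjoint_eqI)
  have b: "a i j \<in> bop" for i j using M mat_pos_in[OF a] by blast
  then show "a True False \<in> bop" .
  fix v u :: "'a vec" assume v: "v \<in> l2" and u: "u \<in> l2"
  have im: "Im (qform a x y) = 0" if "x \<in> l2" "y \<in> l2" for x y
    using a that by (simp add: mat_pos_def)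
  note [simp] = qform_def bop_zero_vec[OF b] bop_scale[OF b] inner_scale_left inner_scale_right
  have "Im (inner_l2 u (a False False u)) = 0" "Im (inner_l2 v (a True True v)) = 0"
    using im[OF u l2_zero] im[OF l2_zero v] by simp_all
  then have "Im (inner_l2 u (a False True v)) = - Im (inner_l2 v (a True False u))"
    "Re (inner_l2 u (a False True v)) = Re (inner_l2 v (a True False u))"
    using im[OF u v] im[OF u l2_scale[OF v], of \<i>] v by simp_all
  then have "inner_l2 u (a False True v) = cnj (inner_l2 v (a True False u))"
    by (simp add: complex_eq_iff)
  then have "cnj (inner_l2 u (a False True v)) = inner_l2 v (a True False u)" by simp
  then show "inner_l2 (a False True v) u = inner_l2 v (a True False u)" by (simp add: inner_cnj)
qed

text \<open>The form at (u, v) is the squared norm of u + x v. As x is arbitrary, these matrices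
  also bring every element of M within reach of statements about positive matrices.\<close>

lemma mat_pos_schwarz:
  assumes vM: "von_neumann_algebra M" and x: "x \<in> M"
  shows "mat_pos M (mat2 op_id x (adjoint x) (op_comp (adjoint x) x))"
  unfolding mat_pos_def
proof (intro conjI allI ballI)
  show "mat2 op_id x (adjoint x) (op_comp (adjoint x) x) i j \<in> M" for i j
    using x vN_id[OF vM] vN_adjoint[OF vM x] vN_comp[OF vM vN_adjoint[OF vM x] x] by (simp add: mat2_def)
  fix u v :: "'a vec" assume uv: "u \<in> l2" "v \<in> l2"
  have xb: "x \<in> bop" by (rule vN_bop[OF vM x])
  have xv: "x v \<in> l2" by (rule bopD(1)[OF xb uv(2)])
  have "qform (mat2 op_id x (adjoint x) (op_comp (adjoint x) x)) u v
     = inner_l2 (\<lambda>i. u i + x v i) (\<lambda>i. u i + x v i)"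
    using uv xv
    by (simp add: qform_def op_id_def op_comp_def adjoint_inner[OF xb] inner_add_left inner_add_right l2_add)
  also have "\<dots> = of_real ((norm_l2 (\<lambda>i. u i + x v i))\<^sup>2)" by (rule inner_self[OF l2_add[OF uv(1) xv]])
  finally show "0 \<le> Re (qform (mat2 op_id x (adjoint x) (op_comp (adjoint x) x)) u v)"
    "Im (qform (mat2 op_id x (adjoint x) (op_comp (adjoint x) x)) u v) = 0" by simp_all
qed

text \<open>Positivity is assumed in one direction only, so the lemma serves an isomorphism and its
  inverse separately.\<close>

lemma kadison_schwarz:
  assumes vM: "von_neumann_algebra M" and vN: "von_neumann_algebra N"
    and pos: "\<forall>a. mat_pos M a \<longrightarrow> mat_pos N (\<lambda>i j. \<phi> (a i j))"
    and unit: "\<phi> op_id = op_id" and x: "x \<in> M"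
  shows "\<phi> (adjoint x) = adjoint (\<phi> x)"
    and "v \<in> l2 \<Longrightarrow> (norm_l2 (\<phi> x v))\<^sup>2 \<le> Re (inner_l2 v (\<phi> (op_comp (adjoint x) x) v))"
    and "v \<in> l2 \<Longrightarrow> Im (inner_l2 v (\<phi> (op_comp (adjoint x) x) v)) = 0"
proof -
  let ?a = "mat2 op_id (\<phi> x) (\<phi> (adjoint x)) (\<phi> (op_comp (adjoint x) x))"
  have a: "mat_pos N ?a" using spec[OF pos, THEN mp, OF mat_pos_schwarz[OF vM x]] by (simp add: mat2_map unit)
  show adj: "\<phi> (adjoint x) = adjoint (\<phi> x)" using mat_pos_adjoint[OF von_neumann_bop[OF vN] a] by simp
  have fb: "\<phi> x \<in> bop" using vN_bop[OF vN] mat_pos_in[OF a, of False True] by simp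
  assume v: "v \<in> l2"
  \<comment> \<open>For fixed second coordinate v, the form of \<open>?a\<close> is smallest at
    first coordinate \<open>- ?w\<close>, where it equals \<open>?z\<close> minus the squared norm
    of \<open>?w\<close>.\<close>
  let ?w = "\<phi> x v" let ?z = "inner_l2 v (\<phi> (op_comp (adjoint x) x) v)"
  have w: "?w \<in> l2" by (rule bopD(1)[OF fb v])
  have mw: "(\<lambda>i. (-1) * ?w i) \<in> l2" by (rule l2_scale[OF w])
  have "inner_l2 v (adjoint (\<phi> x) (\<lambda>i. (-1) * ?w i)) = (-1) * inner_l2 ?w ?w"
    unfolding adjoint_inner[OF fb v mw] by (rule inner_scale_right)
  then have "qform ?a (\<lambda>i. (-1) * ?w i) v = ?z - inner_l2 ?w ?w"
    using mw inner_scale_left[of "-1" ?w] inner_scale_right[of _ "-1" ?w]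
    by (simp add: qform_def op_id_def adj)
  moreover have "0 \<le> Re (qform ?a (\<lambda>i. (-1) * ?w i) v)" "Im (qform ?a (\<lambda>i. (-1) * ?w i) v) = 0"
    using a mw v unfolding mat_pos_def by blast+
  ultimately show "(norm_l2 ?w)\<^sup>2 \<le> Re ?z" "Im ?z = 0" by (simp_all add: inner_self[OF w] flip: of_real_power)
qed

section \<open>Linearity of composition and antilinearity of the adjoint\<close>

lemma inner_op_add:
  assumes "S \<in> bop" "T \<in> bop" "u \<in> l2" "v \<in> l2"
  shows "inner_l2 u (op_add S T v) = inner_l2 u (S v) + inner_l2 u (T v)"
  using assms by (simp add: op_add_def inner_add_right bopD(1))

lemma inner_op_scale: "inner_l2 u (op_scale a T v) = a * inner_l2 u (T v)"
  by (simp add: op_scale_def inner_scale_right)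

lemma op_comp_add_left: "op_comp (op_add a b) c = op_add (op_comp a c) (op_comp b c)"
  by (simp add: op_comp_def op_add_def fun_eq_iff)

lemma op_comp_scale_left: "op_comp (op_scale a b) c = op_scale a (op_comp b c)"
  by (simp add: op_comp_def op_scale_def fun_eq_iff)

lemma op_comp_add_right:
  assumes "a \<in> bop" "b \<in> bop" "c \<in> bop"
  shows "op_comp c (op_add a b) = op_add (op_comp c a) (op_comp c b)"
proof
  fix v show "op_comp c (op_add a b) v = op_add (op_comp c a) (op_comp c b) v"
    using assms by (cases "v \<in> l2") (simp_all add: op_comp_def op_add_def bop_add bopD bop_zero_vec)
qed

lemma op_comp_scale_right:
  assumes "b \<in> bop" "c \<in> bop"
  shows "op_comp c (op_scale a b) = op_scale a (op_comp c b)"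
proof
  fix v show "op_comp c (op_scale a b) v = op_scale a (op_comp c b) v"
    using assms by (cases "v \<in> l2") (simp_all add: op_comp_def op_scale_def bop_scale bopD bop_zero_vec)
qed

lemma bop_op_add:
  assumes "a \<in> bop" "b \<in> bop"
  shows "op_add a b \<in> bop"
proof -
  obtain C where C: "\<forall>v\<in>l2. norm_l2 (a v) \<le> C * norm_l2 v" using bop_bound[OF assms(1)] by (elim exE conjE)
  obtain D where D: "\<forall>v\<in>l2. norm_l2 (b v) \<le> D * norm_l2 v" using bop_bound[OF assms(2)] by (elim exE conjE)
  show ?thesis
  \<comment> \<open>The constant comes from \<open>norm_add_sq_le\<close>, which bounds the squared
    norm of a sum by twice the sum of squares.\<close>
  proof (rule bopI[where C = "sqrt (2 * C\<^sup>2 + 2 * D\<^sup>2)"])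
    fix v :: "'a vec" assume v: "v \<in> l2"
    show "op_add a b v \<in> l2" unfolding op_add_def by (rule l2_add[OF bopD(1)[OF assms(1) v] bopD(1)[OF assms(2) v]])
    have "(norm_l2 (op_add a b v))\<^sup>2 \<le> 2 * (norm_l2 (a v))\<^sup>2 + 2 * (norm_l2 (b v))\<^sup>2"
      unfolding op_add_def
      by (rule norm_add_sq_le[OF bopD(1)[OF assms(1) v] bopD(1)[OF assms(2) v]])
    also have "\<dots> \<le> 2 * (C * norm_l2 v)\<^sup>2 + 2 * (D * norm_l2 v)\<^sup>2"
      using power_mono[OF bspec[OF C v] norm_l2_nonneg, of 2] power_mono[OF bspec[OF D v] norm_l2_nonneg, of 2]
      by linarith
    also have "\<dots> = (sqrt (2 * C\<^sup>2 + 2 * D\<^sup>2) * norm_l2 v)\<^sup>2"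
      by (simp add: power_mult_distrib distrib_right)
    finally show "norm_l2 (op_add a b v) \<le> sqrt (2 * C\<^sup>2 + 2 * D\<^sup>2) * norm_l2 v"
    proof (rule power2_le_imp_le)
      show "0 \<le> sqrt (2 * C\<^sup>2 + 2 * D\<^sup>2) * norm_l2 v" by (intro mult_nonneg_nonneg norm_l2_nonneg) simp
    qed
  qed (use assms in \<open>auto simp: op_add_def bopD fun_eq_iff algebra_simps\<close>)
qed

lemma bop_op_scale:
  assumes "b \<in> bop"
  shows "op_scale a b \<in> bop"
proof -
  obtain C where C: "\<forall>v\<in>l2. norm_l2 (b v) \<le> C * norm_l2 v"
    using bop_bound[OF assms(1)] by (elim exE conjE)
  show ?thesis
  proof (rule bopI[where C = "cmod a * C"])
    fix v :: "'a vec" assume v: "v \<in> l2"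
    show "op_scale a b v \<in> l2" unfolding op_scale_def by (rule l2_scale[OF bopD(1)[OF assms v]])
    show "norm_l2 (op_scale a b v) \<le> cmod a * C * norm_l2 v"
      using mult_left_mono[OF bspec[OF C v] norm_ge_zero[of a]] by (simp add: op_scale_def norm_l2_scale mult.assoc)
  qed (use assms in \<open>auto simp: op_scale_def bopD fun_eq_iff algebra_simps\<close>)
qed

lemma adjoint_add:
  assumes a: "a \<in> bop" and b: "b \<in> bop"
  shows "adjoint (op_add a b) = op_add (adjoint a) (adjoint b)"
proof (rule adjoint_eqI[OF bop_op_add[OF adjoint_bop[OF a] adjoint_bop[OF b]]])
  fix u v :: "'a vec" assume "u \<in> l2" "v \<in> l2"
  then show "inner_l2 (op_add a b u) v = inner_l2 u (op_add (adjoint a) (adjoint b) v)"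
    using a b by (simp add: inner_op_add adjoint_bop adjoint_inner)
      (simp add: op_add_def inner_add_left bopD)
qed

lemma adjoint_scale:
  assumes b: "b \<in> bop"
  shows "adjoint (op_scale a b) = op_scale (cnj a) (adjoint b)"
proof (rule adjoint_eqI[OF bop_op_scale[OF adjoint_bop[OF b]]])
  fix u v :: "'a vec" assume "u \<in> l2" "v \<in> l2"
  then show "inner_l2 (op_scale a b u) v = inner_l2 u (op_scale (cnj a) (adjoint b) v)"
    using b by (simp add: inner_op_scale adjoint_inner) (simp add: op_scale_def inner_scale_left)
qed

lemma star_iso_of_order_iso:
  assumes vM: "von_neumann_algebra M" and vN: "von_neumann_algebra N"
    and bij: "bij_betw \<phi> M N"
    and add: "\<And>x y. x \<in> M \<Longrightarrow> y \<in> M \<Longrightarrow> \<phi> (op_add x y) = op_add (\<phi> x) (\<phi> y)"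
    and scale: "\<And>a x. x \<in> M \<Longrightarrow> \<phi> (op_scale a x) = op_scale a (\<phi> x)"
    and pos: "\<And>a. (\<And>i j. a i j \<in> M) \<Longrightarrow> mat_pos N (\<lambda>i j. \<phi> (a i j)) \<longleftrightarrow> mat_pos M a"
    and unit: "\<phi> op_id = op_id"
  shows "star_iso M N \<phi>"
proof -
  define \<psi> where "\<psi> = inv_into M \<phi>"
  have phiN: "\<phi> x \<in> N" if "x \<in> M" for x using bij that by (auto simp: bij_betw_def)
  have psiM: "\<psi> y \<in> M" "\<phi> (\<psi> y) = y" if "y \<in> N" for y
    using bij that by (auto simp: \<psi>_def bij_betw_def inv_into_into f_inv_into_f)
  have psi_phi: "\<psi> (\<phi> x) = x" if "x \<in> M" for x
    using bij that by (simp add: \<psi>_def bij_betw_def)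
  have posM: "\<forall>a. mat_pos M a \<longrightarrow> mat_pos N (\<lambda>i j. \<phi> (a i j))"
    using pos by (simp add: mat_pos_in)
  have posN: "\<forall>a. mat_pos N a \<longrightarrow> mat_pos M (\<lambda>i j. \<psi> (a i j))"
  proof (intro allI impI)
    fix a assume "mat_pos N a"
    then show "mat_pos M (\<lambda>i j. \<psi> (a i j))"
      using pos[of "\<lambda>i j. \<psi> (a i j)"] by (simp add: psiM mat_pos_in)
  qed
  have unit': "\<psi> op_id = op_id" using psi_phi[OF vN_id[OF vM]] unit by simp
  have phi0: "\<phi> op_zero = op_zero"
    using scale[OF vN_zero[OF vM], of 0] by (simp add: op_zero_scale)
  note ks = kadison_schwarz[OF vM vN posM unit]
  note ks' = kadison_schwarz[OF vN vM posN unit']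
  have adj: "\<phi> (adjoint x) = adjoint (\<phi> x)" if "x \<in> M" for x by (rule ks(1)[OF that])
  have square: "\<phi> (op_comp (adjoint x) x) = op_comp (adjoint (\<phi> x)) (\<phi> x)" if x: "x \<in> M" for x
  proof (rule bop_quad_ext)
    let ?y = "\<phi> x"
    have yN: "?y \<in> N" by (rule phiN[OF x])
    have xx: "op_comp (adjoint x) x \<in> M" and yy: "op_comp (adjoint ?y) ?y \<in> N"
      by (intro vN_comp[OF vM] vN_adjoint[OF vM] x, intro vN_comp[OF vN] vN_adjoint[OF vN] yN)
    show "\<phi> (op_comp (adjoint x) x) \<in> bop" "op_comp (adjoint ?y) ?y \<in> bop"
      using vN_bop[OF vN] phiN[OF xx] yy by auto
    fix v :: "'b vec" assume v: "v \<in> l2"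
    have yv: "?y v \<in> l2" by (rule bopD(1)[OF vN_bop[OF vN yN] v])
    have yyv: "inner_l2 v (op_comp (adjoint ?y) ?y v) = of_real ((norm_l2 (?y v))\<^sup>2)"
      unfolding op_comp_def o_def adjoint_inner[OF vN_bop[OF vN yN] v yv] by (rule inner_self[OF yv])
    \<comment> \<open>Schwarz for the inverse says that the following element is positive; its image then is, too.\<close>
    define z where "z = op_add (\<psi> (op_comp (adjoint ?y) ?y)) (op_scale (-1) (op_comp (adjoint x) x))"
    have zM: "z \<in> M" unfolding z_def by (intro vN_add[OF vM] vN_scale[OF vM] xx psiM yy)
    have "mat_pos M (mat2 z op_zero op_zero op_zero)" unfolding mat_pos_diag
    proof (intro conjI ballI zM vN_zero[OF vM])
      fix w :: "'a vec" assume w: "w \<in> l2"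
      have xw: "x w \<in> l2" by (rule bopD(1)[OF vN_bop[OF vM x] w])
      have xxw: "inner_l2 w (op_comp (adjoint x) x w) = of_real ((norm_l2 (x w))\<^sup>2)"
        unfolding op_comp_def o_def adjoint_inner[OF vN_bop[OF vM x] w xw] by (rule inner_self[OF xw])
      have zw: "inner_l2 w (z w) = inner_l2 w (\<psi> (op_comp (adjoint ?y) ?y) w) - of_real ((norm_l2 (x w))\<^sup>2)"
        unfolding z_def
        by (subst inner_op_add) (auto simp: inner_op_scale xxw w intro!: vN_bop[OF vM] psiM yy vN_scale[OF vM] xx)
      show "0 \<le> Re (inner_l2 w (z w))" "Im (inner_l2 w (z w)) = 0"
        using ks'(2,3)[OF yN w] by (simp_all add: zw psi_phi[OF x] flip: of_real_power)
    qed
    from spec[OF posM, THEN mp, OF this] have "mat_pos N (mat2 (\<phi> z) op_zero op_zero op_zero)" by (simp add: mat2_map phi0)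
    then have "0 \<le> Re (inner_l2 v (\<phi> z v))" using v by (simp add: mat_pos_diag)
    moreover have "\<phi> z = op_add (op_comp (adjoint ?y) ?y) (op_scale (-1) (\<phi> (op_comp (adjoint x) x)))"
      unfolding z_def using xx yy by (simp add: add scale psiM vN_scale[OF vM])
    moreover have "inner_l2 v (op_add (op_comp (adjoint ?y) ?y) (op_scale (-1) (\<phi> (op_comp (adjoint x) x))) v)
       = of_real ((norm_l2 (?y v))\<^sup>2) - inner_l2 v (\<phi> (op_comp (adjoint x) x) v)"
      by (subst inner_op_add) (auto simp: inner_op_scale yyv v intro!: vN_bop[OF vN] yy vN_scale[OF vN] phiN xx)
    ultimately have "Re (inner_l2 v (\<phi> (op_comp (adjoint x) x) v)) \<le> (norm_l2 (?y v))\<^sup>2"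
      by (simp flip: of_real_power)
    then show "inner_l2 v (\<phi> (op_comp (adjoint x) x) v) = inner_l2 v (op_comp (adjoint ?y) ?y v)"
      unfolding yyv using ks(2,3)[OF x v] by (simp add: complex_eq_iff flip: of_real_power)
  qed
  have prod: "\<phi> (op_comp (adjoint y) x) = op_comp (adjoint (\<phi> y)) (\<phi> x)" if x: "x \<in> M" and y: "y \<in> M" for x y
  proof (rule bop_ext)
    show "\<phi> (op_comp (adjoint y) x) \<in> bop" "op_comp (adjoint (\<phi> y)) (\<phi> x) \<in> bop"
      by (auto intro!: vN_bop[OF vN] phiN vN_comp[OF vM] vN_comp[OF vN] vN_adjoint[OF vM] vN_adjoint[OF vN] x y)
    fix u v :: "'b vec" assume uv: "u \<in> l2" "v \<in> l2"
    \<comment> \<open>E is the defect of multiplicativity seen by u and v. It is sesquilinear in (y,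
      x) and vanishes on the diagonal by \<open>square\<close>, so polarization kills it.\<close>
    define E where "E y x = inner_l2 u (\<phi> (op_comp (adjoint y) x) v) - inner_l2 u (op_comp (adjoint (\<phi> y)) (\<phi> x) v)" for y x
    have E0: "E x x = 0" if "x \<in> M" for x by (simp add: E_def square that)
    note mem = vN_bop[OF vM] vN_bop[OF vN] phiN vN_comp[OF vM] vN_comp[OF vN] vN_adjoint[OF vM] vN_adjoint[OF vN]
      vN_scale[OF vM] vN_scale[OF vN] vN_add[OF vM] vN_add[OF vN]
    have addr: "E y (op_add x x') = E y x + E y x'" if "x \<in> M" "x' \<in> M" "y \<in> M" for x x' y
      unfolding E_def using that uv by (simp add: add mem op_comp_add_right inner_op_add)
    have addl: "E (op_add y y') x = E y x + E y' x" if "x \<in> M" "y' \<in> M" "y \<in> M" for x y' y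
      unfolding E_def using that uv by (simp add: add mem op_comp_add_left inner_op_add adjoint_add)
    have scaler: "E y (op_scale a x) = a * E y x" if "x \<in> M" "y \<in> M" for x y a
      unfolding E_def using that by (simp add: scale mem op_comp_scale_right inner_op_scale algebra_simps)
    have scalel: "E (op_scale a y) x = cnj a * E y x" if "x \<in> M" "y \<in> M" for x y a
      unfolding E_def using that by (simp add: scale mem op_comp_scale_left inner_op_scale adjoint_scale algebra_simps)
    have "E y x + E x y = 0"
      using E0[OF vN_add[OF vM y x]] by (simp add: addr addl E0[OF x] E0[OF y] x y mem add.commute)
    moreover have "\<i> * E y x - \<i> * E x y = 0"
      using E0[OF vN_add[OF vM y vN_scale[OF vM x, of \<i>]]] by (simp add: addr addl scaler scalel E0[OF x] E0[OF y] x y mem algebra_simps)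
    ultimately have "E y x = 0" by (rule polarization)
    then show "inner_l2 u (\<phi> (op_comp (adjoint y) x) v) = inner_l2 u (op_comp (adjoint (\<phi> y)) (\<phi> x) v)"
      by (simp add: E_def)
  qed
  \<comment> \<open>Taking \<open>adjoint x\<close> as the starred factor in \<open>prod\<close>
    cancels the star on both sides.\<close>
  have comp: "\<phi> (op_comp x y) = op_comp (\<phi> x) (\<phi> y)" if x: "x \<in> M" and y: "y \<in> M" for x y
    using prod[OF y vN_adjoint[OF vM x]]
    by (simp add: adj[OF x] adjoint_adjoint vN_bop[OF vM x] vN_bop[OF vN phiN[OF x]])
  show ?thesis unfolding star_iso_def using bij add scale adj comp by blast
qed

subsection \<open>The graph of the isomorphism\<close>

lemma mat_pos_scale:
  assumes vM: "von_neumann_algebra M" and a: "mat_pos M a" and c: "0 \<le> c"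
  shows "mat_pos M (\<lambda>i j. op_scale (complex_of_real c) (a i j))"
proof -
  have "qform (\<lambda>i j. op_scale (complex_of_real c) (a i j)) u v = of_real c * qform a u v" for u v
    by (simp add: qform_def inner_op_scale distrib_left)
  then show ?thesis using a c by (simp add: mat_pos_def vN_scale[OF vM])
qed

text \<open>Opens the whole positive cone to statements about \<open>X_set\<close>, which concern
  contractions only.\<close>

lemma mat_pos_scaled_X_set:
  assumes vM: "von_neumann_algebra M" and a: "mat_pos M a"
  shows "\<exists>c>0. (\<lambda>i j. op_scale (complex_of_real c) (a i j)) \<in> X_set M"
proof -
  have b: "a i j \<in> bop" for i j using vN_bop[OF vM] mat_pos_in[OF a] by blast
  have "\<forall>p. \<exists>C>0. \<forall>v\<in>l2. norm_l2 (a (fst p) (snd p) v) \<le> C * norm_l2 v" by (intro allI bop_bound b)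
  then obtain C where C: "\<forall>p. 0 < C p \<and> (\<forall>v\<in>l2. norm_l2 (a (fst p) (snd p) v) \<le> C p * norm_l2 v)"
    by (rule exE[OF choice])
  define K where "K = (\<Sum>p\<in>UNIV. C p)"
  have CK: "C p \<le> K" for p unfolding K_def using C by (intro member_le_sum) (auto intro: less_imp_le)
  then have K: "0 < K" using C by (meson less_le_trans)
  have bd: "norm_l2 (a i j v) \<le> K * norm_l2 v" if "v \<in> l2" for i j v
    using C that mult_right_mono[OF CK[of "(i, j)"] norm_l2_nonneg[of v]] by (metis fst_conv snd_conv order_trans)
  \<comment> \<open>The factor gives each entry norm at most 1/2; \<open>norm_add_sq_le\<close>
    doubles the resulting quarters, and the two rows then add up to exactly the squared norm of (u,
    v).\<close>
  define c where "c = 1 / (2 * K)"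
  have c: "0 < c" using K by (simp add: c_def)
  have bd': "(norm_l2 (op_scale (of_real c) (a i j) v))\<^sup>2 \<le> (norm_l2 v)\<^sup>2 / 4" if "v \<in> l2" for i j v
  proof -
    have "norm_l2 (op_scale (of_real c) (a i j) v) \<le> norm_l2 v / 2"
      unfolding op_scale_def norm_l2_scale norm_of_real
      using bd[OF that, of i j] K by (simp add: c_def field_simps)
    then have "(norm_l2 (op_scale (of_real c) (a i j) v))\<^sup>2 \<le> (norm_l2 v / 2)\<^sup>2" by (intro power_mono) auto
    then show ?thesis by (simp add: power_divide)
  qed
  have "mat_contr (\<lambda>i j. op_scale (complex_of_real c) (a i j))" unfolding mat_contr_def
  proof (intro ballI)
    fix u v :: "'a vec" assume uv: "u \<in> l2" "v \<in> l2"
    let ?f = "\<lambda>i j. op_scale (complex_of_real c) (a i j)"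
    have row: "(norm_l2 (\<lambda>k. ?f i False u k + ?f i True v k))\<^sup>2 \<le> (norm_l2 u)\<^sup>2 / 2 + (norm_l2 v)\<^sup>2 / 2" for i
      using norm_add_sq_le[OF bopD(1)[OF bop_op_scale[OF b] uv(1)] bopD(1)[OF bop_op_scale[OF b] uv(2)],
          of "of_real c" i False "of_real c" i True] bd'[OF uv(1), of i False] bd'[OF uv(2), of i True]
      by linarith
    show "(norm_l2 (\<lambda>k. ?f False False u k + ?f False True v k))\<^sup>2
      + (norm_l2 (\<lambda>k. ?f True False u k + ?f True True v k))\<^sup>2 \<le> (norm_l2 u)\<^sup>2 + (norm_l2 v)\<^sup>2"
      using row[of False] row[of True] by linarith
  qed
  then show ?thesis using mat_pos_scale[OF vM a less_imp_le[OF c]] c X_set_iff[OF von_neumann_bop[OF vM]] by blast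
qed

lemma X_set_id:
  fixes M :: "'i op set"
  assumes "von_neumann_algebra M"
  shows "mat2 op_id op_zero op_zero op_zero \<in> X_set M"
  unfolding X_set_iff[OF von_neumann_bop[OF assms]]
proof
  have "0 \<le> Re (inner_l2 v (op_id v)) \<and> Im (inner_l2 v (op_id v)) = 0"
    if "v \<in> l2" for v :: "'i vec"
    using that by (simp add: op_id_def inner_self flip: of_real_power)
  then show "mat_pos M (mat2 op_id op_zero op_zero op_zero)"
    by (simp add: mat_pos_diag vN_id vN_zero assms)
  show "mat_contr (mat2 op_id op_zero op_zero op_zero)"
    by (simp add: mat_contr_def op_id_def op_zero_def)
qed

text \<open>Cauchy-Schwarz and contractivity of the entry place the corner below the identity, in
  the language of quadratic forms.\<close>

lemma X_set_corner:
  assumes vM: "von_neumann_algebra M" and a: "a \<in> X_set M" and v: "v \<in> l2"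
  shows "Im (inner_l2 v (a False False v)) = 0" "Re (inner_l2 v (a False False v)) \<le> (norm_l2 v)\<^sup>2"
proof -
  note Mb = von_neumann_bop[OF vM]
  have pos: "mat_pos M a" using a by (simp add: X_set_iff[OF Mb])
  have b: "a i j \<in> bop" for i j using vN_bop[OF vM] mat_pos_in[OF pos] by blast
  have "Im (qform a v (\<lambda>_. 0)) = 0" using pos v l2_zero unfolding mat_pos_def by blast
  then show "Im (inner_l2 v (a False False v)) = 0" by (simp add: qform_def bop_zero_vec[OF b])
  have "Re (inner_l2 v (a False False v)) \<le> norm_l2 v * norm_l2 (a False False v)"
    by (rule order_trans[OF complex_Re_le_cmod cauchy_schwarz[OF v bopD(1)[OF b v]]])
  also have "\<dots> \<le> norm_l2 v * norm_l2 v"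
    using X_set_entry[OF Mb a, of False False] v by (intro mult_left_mono) (auto simp: opball_def)
  finally show "Re (inner_l2 v (a False False v)) \<le> (norm_l2 v)\<^sup>2" by (simp add: power2_eq_square)
qed

text \<open>Scale into \<open>X_set\<close>, take a partner there and undo the scaling by 1 / c:
  joint homogeneity of L keeps the value zero.\<close>

lemma pos_transfer:
  assumes vM: "von_neumann_algebra M" and vN: "von_neumann_algebra N" and L: "L \<in> Lset M LM N LN"
    and near: "\<forall>x\<in>X_set M. \<exists>y\<in>X_set N. \<forall>i j. L (x i j, op_scale (-1) (y i j)) = 0"
    and a: "mat_pos M a"
  shows "\<exists>b. mat_pos N b \<and> (\<forall>i j. L (a i j, op_scale (-1) (b i j)) = 0)"
proof -
  obtain c where c: "0 < c" "(\<lambda>i j. op_scale (complex_of_real c) (a i j)) \<in> X_set M"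
    using mat_pos_scaled_X_set[OF vM a] by (elim exE conjE)
  obtain y where y: "y \<in> X_set N" "\<forall>i j. L (op_scale (complex_of_real c) (a i j), op_scale (-1) (y i j)) = 0"
    using bspec[OF near c(2)] by (elim bexE)
  have yp: "mat_pos N y" using y(1) by (simp add: X_set_iff[OF von_neumann_bop[OF vN]])
  let ?d = "complex_of_real (1 / c)"
  have "L (a i j, op_scale (-1) (op_scale ?d (y i j))) = 0" for i j
  proof -
    have m: "op_scale (complex_of_real c) (a i j) \<in> M" "op_scale (-1) (y i j) \<in> N"
      by (intro vN_scale[OF vM] vN_scale[OF vN] mat_pos_in a yp)+
    have "op_scale ?d (op_scale (complex_of_real c) (a i j)) = a i j"
      using c(1) by (simp add: op_scale_scale op_scale_one)
    moreover have "op_scale ?d (op_scale (-1) (y i j)) = op_scale (-1) (op_scale ?d (y i j))"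
      by (simp add: op_scale_scale)
    ultimately show ?thesis using LsetD(2)[OF L m, of ?d] y(2) by simp
  qed
  moreover have "mat_pos N (\<lambda>i j. op_scale ?d (y i j))" using c(1) by (intro mat_pos_scale vN yp) simp
  ultimately show ?thesis by blast
qed

theorem mainTheorem8:
  fixes M :: "'i op set" and LM :: "'i op \<Rightarrow> real"
    and N :: "'j op set" and LN :: "'j op \<Rightarrow> real"
  assumes "LvNA M LM" and "LvNA N LN"
    and "dist_qGH M LM N LN = 0"
  shows "\<exists>\<phi>. star_iso M N \<phi> \<and> (\<forall>x\<in>M. LN (\<phi> x) = LM x)"
proof -
  note vM = LvNA_D(1)[OF assms(1)] and vN = LvNA_D(1)[OF assms(2)]
  obtain L where L: "L \<in> Lset M LM N LN"
    and near: "\<forall>x\<in>X_set M. \<exists>y\<in>X_set N. \<forall>i j. L (x i j, op_scale (-1) (y i j)) = 0"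
    and near': "\<forall>y\<in>X_set N. \<exists>x\<in>X_set M. \<forall>i j. L (x i j, op_scale (-1) (y i j)) = 0"
    by (rule dist_zero_attained[OF assms])
  \<comment> \<open>A relation comes first because \<open>near\<close> speaks only of matrices in
    \<open>X_set\<close>: partners of individual elements are not yet known to exist or to be
    unique.\<close>
  define R where "R x y \<longleftrightarrow> x \<in> M \<and> y \<in> N \<and> L (x, op_scale (-1) y) = 0" for x y
  have RM: "x \<in> M" and RN: "y \<in> N" if "R x y" for x y using that by (auto simp: R_def)
  have R0: "L (x, op_scale (-1) y) = 0" if "R x y" for x y using that by (simp add: R_def)
  have R_add: "R (op_add x x') (op_add y y')" if "R x y" "R x' y'" for x y x' y'
  proof -
    note m = RM[OF that(1)] RN[OF that(1)] RM[OF that(2)] RN[OF that(2)]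
    have "L (op_add x x', op_add (op_scale (-1) y) (op_scale (-1) y')) \<le> 0"
      using LsetD(3)[OF L m(1) vN_scale[OF vN m(2)] m(3) vN_scale[OF vN m(4)], of "-1" "-1"]
      by (simp add: R0[OF that(1)] R0[OF that(2)])
    moreover have "0 \<le> L (op_add x x', op_add (op_scale (-1) y) (op_scale (-1) y'))"
      by (intro LsetD(1)[OF L] vN_add[OF vM] vN_add[OF vN] vN_scale[OF vN] m)
    ultimately show ?thesis unfolding R_def op_scale_add by (simp add: vN_add[OF vM] vN_add[OF vN] m)
  qed
  have R_scale: "R (op_scale a x) (op_scale a y)" if "R x y" for x y a
  proof -
    note m = RM[OF that] RN[OF that]
    have "op_scale (-1) (op_scale a y) = op_scale a (op_scale (-1) y)" by (simp add: op_scale_scale)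
    then show ?thesis
      using LsetD(2)[OF L m(1) vN_scale[OF vN m(2)], of a "-1"] R0[OF that] m
      by (simp add: R_def vN_scale[OF vM] vN_scale[OF vN])
  qed
  have R_norm: "LN y = LM x" if "R x y" for x y
  proof (rule antisym)
    note m = RM[OF that] RN[OF that]
    have my: "op_scale (-1) y \<in> N" and mx: "op_scale (-1) x \<in> M" by (intro vN_scale[OF vN] vN_scale[OF vM] m)+
    \<comment> \<open>Adding (0, y) to the null pair (x, - y) leaves (x, 0), which compares
      \<open>LM x\<close> with \<open>LN y\<close>; adding (- x, 0) gives the reverse bound.\<close>
    have "L (op_add x op_zero, op_add (op_scale (-1) y) y) \<le> L (x, op_scale (-1) y) + L (op_zero, y)"
      by (rule LsetD(3)[OF L m(1) my vN_zero[OF vM] m(2)])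
    moreover have "op_add (op_scale (-1) y) y = op_zero" by (simp add: op_defs)
    ultimately show "LM x \<le> LN y" using m by (simp add: op_add_zero R0[OF that] LsetD(4,5)[OF L])
    have "L (op_add x (op_scale (-1) x), op_add (op_scale (-1) y) op_zero) \<le> L (x, op_scale (-1) y) + L (op_scale (-1) x, op_zero)"
      by (rule LsetD(3)[OF L m(1) my mx vN_zero[OF vN]])
    then show "LN y \<le> LM x"
      by (simp add: op_diff_self op_add_zero R0[OF that] LsetD(4)[OF L mx] LsetD(5)[OF L my]
          LvNA_D(5)[OF assms(1) m(1)] LvNA_D(5)[OF assms(2) m(2)])
  qed
  have R_fun: "y = y'" if "R x y" "R x y'" for x y y'
  proof -
    \<comment> \<open>By linearity the difference of two partners is a partner of zero, so
      \<open>R_norm\<close> makes its Lip-norm vanish.\<close>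
    have d: "R op_zero (op_add y (op_scale (-1) y'))"
      using R_add[OF that(1) R_scale[OF that(2), of "-1"]] by (simp add: op_diff_self)
    then have "LN (op_add y (op_scale (-1) y')) = 0"
      using R_norm[OF d] LvNA_D(4)[OF assms(1) vN_zero[OF vM]] by simp
    then show ?thesis unfolding LvNA_D(4)[OF assms(2) RN[OF d]] by (rule op_diff_eq_zero)
  qed
  have R_inj: "x = x'" if "R x y" "R x' y" for x x' y
  proof -
    have d: "R (op_add x (op_scale (-1) x')) op_zero"
      using R_add[OF that(1) R_scale[OF that(2), of "-1"]] by (simp add: op_diff_self)
    then have "LM (op_add x (op_scale (-1) x')) = 0"
      using R_norm[OF d] LvNA_D(4)[OF assms(2) vN_zero[OF vN]] by simp
    then show ?thesis unfolding LvNA_D(4)[OF assms(1) RM[OF d]] by (rule op_diff_eq_zero)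
  qed
  have flip: "L (op_scale (-1) x, y) = L (x, op_scale (-1) y)" if "x \<in> M" "y \<in> N" for x y
    by (rule Lset_flip[OF L vN that])
  have pos: "\<exists>b. mat_pos N b \<and> (\<forall>i j. R (a i j) (b i j))" if a: "mat_pos M a" for a
  proof -
    obtain b where "mat_pos N b" "\<forall>i j. L (a i j, op_scale (-1) (b i j)) = 0"
      using pos_transfer[OF vM vN L near a] by (elim exE conjE)
    then show ?thesis by (intro exI[of _ b]) (simp add: R_def mat_pos_in a)
  qed
  have pos': "\<exists>a. mat_pos M a \<and> (\<forall>i j. R (a i j) (b i j))" if b: "mat_pos N b" for b
  proof -
    have n: "\<forall>y\<in>X_set N. \<exists>x\<in>X_set M. \<forall>i j. (\<lambda>p. L (snd p, fst p)) (y i j, op_scale (-1) (x i j)) = 0"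
    proof
      fix y assume y: "y \<in> X_set N"
      obtain x where x: "x \<in> X_set M" "\<forall>i j. L (x i j, op_scale (-1) (y i j)) = 0"
        using bspec[OF near' y] by (elim bexE)
      then have "L (op_scale (-1) (x i j), y i j) = 0" for i j
        using y flip[of "x i j" "y i j"] by (simp add: X_set_def)
      with x(1) show "\<exists>x\<in>X_set M. \<forall>i j. (\<lambda>p. L (snd p, fst p)) (y i j, op_scale (-1) (x i j)) = 0" by auto
    qed
    obtain a where a: "mat_pos M a" "\<forall>i j. (\<lambda>p. L (snd p, fst p)) (b i j, op_scale (-1) (a i j)) = 0"
      using pos_transfer[OF vN vM Lset_swap[OF L] n b] by (elim exE conjE)
    then show ?thesis by (intro exI[of _ a]) (simp add: R_def mat_pos_in b flip)
  qed
  \<comment> \<open>Although x need not be positive, it is an off-diagonal entry of the positive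
    Schwarz matrix, and the partner of that matrix contains one for x.\<close>
  have "\<exists>y. R x y" if x: "x \<in> M" for x
    using pos[OF mat_pos_schwarz[OF vM x]] by (metis mat2_simps(2))
  then have "\<forall>x\<in>M. \<exists>y. R x y" by blast
  then obtain \<phi> where "\<forall>x\<in>M. R x (\<phi> x)" by (rule exE[OF bchoice])
  then have \<phi>: "R x (\<phi> x)" if "x \<in> M" for x using that by blast
  have \<phi>_eq: "\<phi> x = y" if "R x y" for x y by (rule R_fun[OF \<phi>[OF RM[OF that]] that])
  have surj: "\<exists>x. R x y" if y: "y \<in> N" for y
    using pos'[OF mat_pos_schwarz[OF vN y]] by (metis mat2_simps(2))
  have bij: "bij_betw \<phi> M N" unfolding bij_betw_def
  proof (intro conjI equalityI subsetI inj_onI)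
    fix x x' assume x: "x \<in> M" "x' \<in> M" "\<phi> x = \<phi> x'"
    show "x = x'" using \<phi>[OF x(1)] \<phi>[OF x(2)] unfolding x(3) by (rule R_inj)
  next
    fix y assume "y \<in> \<phi> ` M"
    then show "y \<in> N" using RN[OF \<phi>] by blast
  next
    fix y assume "y \<in> N"
    then obtain x where x: "R x y" using surj by blast
    from \<phi>_eq[OF x] RM[OF x] show "y \<in> \<phi> ` M" by blast
  qed
  have add: "\<phi> (op_add x y) = op_add (\<phi> x) (\<phi> y)" if "x \<in> M" "y \<in> M" for x y
    by (rule \<phi>_eq[OF R_add[OF \<phi>[OF that(1)] \<phi>[OF that(2)]]])
  have scale: "\<phi> (op_scale a x) = op_scale a (\<phi> x)" if "x \<in> M" for a x
    by (rule \<phi>_eq[OF R_scale[OF \<phi>[OF that]]])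
  have \<phi>_pos: "mat_pos N (\<lambda>i j. \<phi> (a i j)) \<longleftrightarrow> mat_pos M a" if aM: "\<And>i j. a i j \<in> M" for a
  proof
    assume "mat_pos M a"
    then obtain b where b: "mat_pos N b" "\<forall>i j. R (a i j) (b i j)" using pos by blast
    then have "(\<lambda>i j. \<phi> (a i j)) = b" by (intro ext \<phi>_eq) simp
    then show "mat_pos N (\<lambda>i j. \<phi> (a i j))" using b(1) by simp
  next
    assume "mat_pos N (\<lambda>i j. \<phi> (a i j))"
    then obtain b where b: "mat_pos M b" "\<forall>i j. R (b i j) (\<phi> (a i j))" using pos' by blast
    \<comment> \<open>Injectivity of R identifies the given matrix with the positive one found for
      its image.\<close>
    have "a = b" by (intro ext R_inj[OF \<phi>[OF aM]]) (simp add: b)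
    then show "mat_pos M a" using b(1) by simp
  qed
  have unit: "\<phi> op_id = op_id"
  proof (rule bop_quad_ext)
    have 1: "\<phi> op_id \<in> N" by (rule RN[OF \<phi>[OF vN_id[OF vM]]])
    show b: "\<phi> op_id \<in> bop" "(op_id :: 'j op) \<in> bop" by (rule vN_bop[OF vN 1], rule vN_bop[OF vN vN_id[OF vN]])
    \<comment> \<open>The corner of this partner is \<open>\<phi> op_id\<close>, which
      \<open>X_set_corner\<close> therefore places below the identity of N.\<close>
    obtain y where y: "y \<in> X_set N" "\<forall>i j. L (mat2 op_id op_zero op_zero op_zero i j, op_scale (-1) (y i j)) = 0"
      using bspec[OF near X_set_id[OF vM]] by (elim bexE)
    have "R op_id (y False False)"
      using y(1) spec[OF spec[OF y(2), of False], of False] by (simp add: R_def vN_id[OF vM] X_set_def)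
    then have y1: "y False False = \<phi> op_id" by (rule \<phi>_eq[symmetric])
    \<comment> \<open>For the opposite inequality, the corner p of the partner lies below the
      identity of M and is mapped to \<open>op_id\<close>. Hence \<open>?q\<close> is positive, and
      so is its image, \<open>\<phi> op_id\<close> minus the identity.\<close>
    obtain x where x: "x \<in> X_set M" "\<forall>i j. L (x i j, op_scale (-1) (mat2 op_id op_zero op_zero op_zero i j)) = 0"
      using bspec[OF near' X_set_id[OF vN]] by (elim bexE)
    define p where "p = x False False"
    have pM: "p \<in> M" using x(1) by (simp add: X_set_def p_def)
    have "R p op_id"
      using pM spec[OF spec[OF x(2), of False], of False] by (simp add: R_def vN_id[OF vN] p_def)
    then have \<phi>p: "\<phi> p = op_id" by (rule \<phi>_eq)
    let ?q = "op_add op_id (op_scale (-1) p)"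
    have qM: "?q \<in> M" by (intro vN_add[OF vM] vN_scale[OF vM] vN_id[OF vM] pM)
    have "mat_pos M (mat2 ?q op_zero op_zero op_zero)" unfolding mat_pos_diag
    proof (intro conjI ballI qM vN_zero[OF vM])
      fix v :: "'i vec" assume v: "v \<in> l2"
      have idv: "inner_l2 v (op_id v) = of_real ((norm_l2 v)\<^sup>2)" using v by (simp add: op_id_def inner_self)
      have "inner_l2 v (?q v) = of_real ((norm_l2 v)\<^sup>2) - inner_l2 v (p v)"
        using v by (subst inner_op_add)
          (auto simp: inner_op_scale idv intro!: vN_bop[OF vM] vN_id[OF vM] vN_scale[OF vM] pM)
      then show "0 \<le> Re (inner_l2 v (?q v))" "Im (inner_l2 v (?q v)) = 0"
        using X_set_corner[OF vM x(1) v] by (simp_all add: p_def flip: of_real_power)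
    qed
    then have "mat_pos N (\<lambda>i j. \<phi> (mat2 ?q op_zero op_zero op_zero i j))"
      by (subst \<phi>_pos) (auto intro: mat_pos_in)
    moreover have "\<phi> op_zero = op_zero"
      using scale[OF vN_zero[OF vM], of 0] by (simp add: op_zero_scale)
    moreover have "\<phi> ?q = op_add (\<phi> op_id) (op_scale (-1) op_id)"
      by (simp add: add scale vN_id[OF vM] vN_scale[OF vM] pM \<phi>p)
    ultimately have q: "mat_pos N (mat2 (op_add (\<phi> op_id) (op_scale (-1) op_id)) op_zero op_zero op_zero)"
      by (simp add: mat2_map)
    fix v :: "'j vec" assume v: "v \<in> l2"
    have idv: "inner_l2 v (op_id v) = of_real ((norm_l2 v)\<^sup>2)" using v by (simp add: op_id_def inner_self)
    have "inner_l2 v (op_add (\<phi> op_id) (op_scale (-1) op_id) v) = inner_l2 v (\<phi> op_id v) - of_real ((norm_l2 v)\<^sup>2)"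
      using v b by (subst inner_op_add) (auto simp: inner_op_scale idv intro!: bop_op_scale)
    moreover have "0 \<le> Re (inner_l2 v (op_add (\<phi> op_id) (op_scale (-1) op_id) v))"
      using q v by (simp add: mat_pos_diag)
    ultimately have "(norm_l2 v)\<^sup>2 \<le> Re (inner_l2 v (\<phi> op_id v))"
      by (simp flip: of_real_power)
    then show "inner_l2 v (\<phi> op_id v) = inner_l2 v (op_id v)"
      using X_set_corner[OF vN y(1) v] unfolding y1 idv by (simp add: complex_eq_iff flip: of_real_power)
  qed
  have "star_iso M N \<phi>" by (rule star_iso_of_order_iso[OF vM vN bij add scale \<phi>_pos unit])
  then show ?thesis using R_norm[OF \<phi>] by blast
qed

end
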